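(* (a) There is a closed factor of the Thue-Morse sequence of every length. (b) There is a 15-state automaton accepting the base-$2$ representation of those $n$ for which there is a closed factor of the Rudin-Shapiro sequence of length $n$. (c) There is an 11-state automaton accepting the base-$2$ representation of those $n$ for which there is a closed factor of the ordinary paperfolding sequence of length $n$. (d) There is a closed factor of the period-doubling sequence of every length. (e) There is a closed factor of the Fibonacci sequence of every length.
   Context: $|x|_w$ is the number of (possibly overlapping) occurrences of $w$ as a factor of $x$. A nonempty word $w$ is a border of $x$ if it is both a prefix and a suffix of $x$. A word $x$ is closed if $|x|\le 1$ or $x$ has a border $w$ with $|x|_w=2$. Sequences: - Thue-Morse: the fixed point starting with $0$ of the morphism $0\to01$, $1\to10$. - Rudin-Shapiro ($00010010\cdots$): the image under the coding $n\mapsto\lfloor n/2\rfloor$ of the fixed point starting with $0$ of $0\to01$, $1\to02$, $2\to31$, $3\to32$. - Ordinary paperfolding ($00100110\cdots$): $p_{2n+1}=p_n$, $p_{4n}=0$, $p_{4n+2}=1$ for all $n\ge0$. - Period-doubling ($10111010\cdots$): the fixed point starting with $1$ of $1\to10$, $0\to11$. - Fibonacci ($01001010\cdots$): the fixed point starting with $0$ of $0\to01$, $1\to0$. Automata are deterministic finite automata over $\{0,1\}$ reading base-$2$ representations most significant digit first (missing transitions, if any, reject). "Accepting the base-$2$ representation of those $n$ for which a property holds" means: for every $n\ge 0$, the automaton accepts the base-$2$ representation of $n$ if and only if $n$ has the property. *)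

theory Defs
  imports "HOL-Library.Sublist"
begin

section \<open>Closed words\<close>

definition occurrences :: "'a list \<Rightarrow> 'a list \<Rightarrow> nat" where
  "occurrences w x = card {i. i + length w \<le> length x \<and> take (length w) (drop i x) = w}"

definition border :: "'a list \<Rightarrow> 'a list \<Rightarrow> bool" where
  "border w x \<longleftrightarrow> w \<noteq> [] \<and> prefix w x \<and> suffix w x"

definition closed_word :: "'a list \<Rightarrow> bool" where
  "closed_word x \<longleftrightarrow> length x \<le> 1 \<or> (\<exists>w. border w x \<and> occurrences w x = 2)"

section \<open>Infinite words\<close>

text \<open>Infinite words are functions on the natural numbers, indexed from 0.\<close>

definition factor :: "'a list \<Rightarrow> (nat \<Rightarrow> 'a) \<Rightarrow> bool" where
  "factor x u \<longleftrightarrow> (\<exists>i. x = map u [i..<i + length x])"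

definition has_closed_factor :: "(nat \<Rightarrow> 'a) \<Rightarrow> nat \<Rightarrow> bool" where
  "has_closed_factor u n \<longleftrightarrow> (\<exists>x. factor x u \<and> length x = n \<and> closed_word x)"

text \<open>A morphism is given by the images of the letters. For a morphism that erases no letter,
  an infinite word \<open>u\<close> is a fixed point iff the image of every finite prefix of \<open>u\<close> is again
  a prefix of \<open>u\<close>.\<close>

definition morph :: "('a \<Rightarrow> 'b list) \<Rightarrow> 'a list \<Rightarrow> 'b list" where
  "morph h x = concat (map h x)"

definition is_fixed_point :: "('a \<Rightarrow> 'a list) \<Rightarrow> (nat \<Rightarrow> 'a) \<Rightarrow> bool" where
  "is_fixed_point h u \<longleftrightarrow>
     (\<forall>n. morph h (map u [0..<n]) = map u [0..<length (morph h (map u [0..<n]))])"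

definition fixed_point :: "('a \<Rightarrow> 'a list) \<Rightarrow> 'a \<Rightarrow> nat \<Rightarrow> 'a" where
  "fixed_point h a = (THE u. u 0 = a \<and> is_fixed_point h u)"

lemma morph_append: "morph h (x @ y) = morph h x @ morph h y"
  by (simp add: morph_def)

lemma morph_mono_prefix: "prefix x y \<Longrightarrow> prefix (morph h x) (morph h y)"
  by (auto simp: prefix_def morph_append)

lemma length_morph_ge:
  assumes "\<And>c. h c \<noteq> []"
  shows "length x \<le> length (morph h x)"
proof (induction x)
  case (Cons c x)
  have "Suc 0 \<le> length (h c)" using assms by (simp add: Suc_le_eq)
  with Cons show ?case by (simp add: morph_def)
qed (simp add: morph_def)

lemma ex1_fixed_point:
  assumes ne: "\<And>c. h c \<noteq> []" and ha: "h a = a # v" "v \<noteq> []"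
  shows "\<exists>!u. u 0 = a \<and> is_fixed_point h u"
proof -
  have longer: "length x < length (morph h x)" if x0: "x \<noteq> []" "hd x = a" for x
  proof -
    obtain y where x: "x = a # y" using x0 by (cases x) auto
    have "length y \<le> length (morph h y)" by (rule length_morph_ge[OF ne])
    then show ?thesis using ha by (cases v) (auto simp: x morph_def)
  qed
  define X where "X k = (morph h ^^ k) [a]" for k
  have X0: "X 0 = [a]" and XS: "X (Suc k) = morph h (X k)" for k
    by (simp_all add: X_def)
  have step: "prefix (X k) (X (Suc k))" for k
  proof (induction k)
    case 0
    show ?case using ha by (simp add: XS X0 morph_def)
  next
    case (Suc k)
    then show ?case using morph_mono_prefix XS by metis
  qed
  have mono: "prefix (X k) (X (k + d))" for k d
    by (induction d) (use step prefix_order.trans in auto)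
  have hdX: "X k \<noteq> [] \<and> hd (X k) = a" for k
    using mono[of 0 k] by (auto simp: X0 prefix_def)
  have lenX: "k < length (X k)" for k
  proof (induction k)
    case (Suc k)
    then show ?case using longer[of "X k"] hdX[of k] by (simp add: XS)
  qed (simp add: X0)
  define u where "u n = X n ! n" for n
  have u_nth: "u n = X k ! n" if "n < length (X k)" for n k
  proof (cases "k \<le> n")
    case True
    then show ?thesis using that mono[of k "n - k"] by (auto simp: u_def prefix_def nth_append)
  next
    case False
    then show ?thesis using lenX[of n] mono[of n "k - n"]
      by (auto simp: u_def prefix_def nth_append)
  qed
  have u_pre: "y = map u [0..<length y]" if y: "prefix y (X k)" for y k
  proof (rule nth_equalityI)
    fix i assume i: "i < length y"
    obtain z where "X k = y @ z" using y by (auto simp: prefix_def)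
    then show "y ! i = map u [0..<length y] ! i" using i u_nth[of i k] by (simp add: nth_append)
  qed simp
  have "u 0 = a" by (simp add: u_def X0)
  moreover have "is_fixed_point h u"
    unfolding is_fixed_point_def
  proof
    fix n
    have "take n (X n) = map u [0..<n]"
      using u_pre[of "take n (X n)" n] lenX[of n] by (simp add: take_is_prefix)
    then have "prefix (map u [0..<n]) (X n)" by (metis take_is_prefix)
    then have "prefix (morph h (map u [0..<n])) (X (Suc n))"
      using morph_mono_prefix XS by metis
    then show "morph h (map u [0..<n]) = map u [0..<length (morph h (map u [0..<n]))]"
      by (rule u_pre)
  qed
  moreover have "s = t" if s: "s 0 = a \<and> is_fixed_point h s" and t: "t 0 = a \<and> is_fixed_point h t"
    for s t
  proof
    fix n
    show "s n = t n"
    proof (induction n rule: less_induct)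
      case (less n)
      show ?case
      proof (cases "n = 0")
        case True
        then show ?thesis using s t by simp
      next
        case False
        have eq: "map s [0..<n] = map t [0..<n]" using less by simp
        let ?m = "morph h (map s [0..<n])"
        have "?m = map s [0..<length ?m]" and "?m = map t [0..<length ?m]"
          using s t eq unfolding is_fixed_point_def by metis+
        moreover have "n < length ?m"
          using longer[of "map s [0..<n]"] s False by (simp add: hd_map)
        ultimately show ?thesis by (metis add_0 length_upt nth_map nth_upt minus_nat.diff_0)
      qed
    qed
  qed
  ultimately show ?thesis by blast
qed

lemma fixed_point_props:
  assumes "\<And>c. h c \<noteq> []" and "h a = a # v" "v \<noteq> []"
  shows "fixed_point h a 0 = a" "is_fixed_point h (fixed_point h a)"
  using theI'[OF ex1_fixed_point[of h a v, OF assms]] by (simp_all add: fixed_point_def)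

section \<open>The sequences\<close>

text \<open>Letters are natural numbers. The last equation of each morphism below also assigns an image
  to the numbers outside the alphabet; these never occur in the fixed points.\<close>

fun thue_morse_morphism :: "nat \<Rightarrow> nat list" where
  "thue_morse_morphism 0 = [0, 1]"
| "thue_morse_morphism _ = [1, 0]"

definition thue_morse :: "nat \<Rightarrow> nat" where
  "thue_morse = fixed_point thue_morse_morphism 0"

definition rudin_shapiro_morphism :: "nat \<Rightarrow> nat list" where
  "rudin_shapiro_morphism c =
     (if c = 0 then [0, 1] else if c = 1 then [0, 2] else if c = 2 then [3, 1] else [3, 2])"

definition rudin_shapiro :: "nat \<Rightarrow> nat" where
  "rudin_shapiro n = fixed_point rudin_shapiro_morphism 0 n div 2"

function paperfolding :: "nat \<Rightarrow> nat" where
  "paperfolding n =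
     (if odd n then paperfolding (n div 2) else if n mod 4 = 0 then 0 else 1)"
  by auto
termination
  by (relation "measure id") (auto elim!: oddE)

declare paperfolding.simps [simp del]

lemma paperfolding_rec:
  "paperfolding (2 * n + 1) = paperfolding n"
  "paperfolding (4 * n) = 0"
  "paperfolding (4 * n + 2) = 1"
proof -
  show "paperfolding (2 * n + 1) = paperfolding n"
    by (subst paperfolding.simps) simp
  show "paperfolding (4 * n) = 0"
    by (subst paperfolding.simps) simp
  have "(4 * n + 2) mod 4 = 2" by presburger
  then show "paperfolding (4 * n + 2) = 1"
    by (subst paperfolding.simps) simp
qed

fun period_doubling_morphism :: "nat \<Rightarrow> nat list" where
  "period_doubling_morphism 0 = [1, 1]"
| "period_doubling_morphism _ = [1, 0]"

definition period_doubling :: "nat \<Rightarrow> nat" where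
  "period_doubling = fixed_point period_doubling_morphism 1"

fun fibonacci_morphism :: "nat \<Rightarrow> nat list" where
  "fibonacci_morphism 0 = [0, 1]"
| "fibonacci_morphism _ = [0]"

definition fibonacci_word :: "nat \<Rightarrow> nat" where
  "fibonacci_word = fixed_point fibonacci_morphism 0"

lemma fixed_point_sequences:
  "thue_morse 0 = 0" "is_fixed_point thue_morse_morphism thue_morse"
  "fixed_point rudin_shapiro_morphism 0 0 = 0"
  "is_fixed_point rudin_shapiro_morphism (fixed_point rudin_shapiro_morphism 0)"
  "period_doubling 0 = 1" "is_fixed_point period_doubling_morphism period_doubling"
  "fibonacci_word 0 = 0" "is_fixed_point fibonacci_morphism fibonacci_word"
proof -
  have ne: "thue_morse_morphism c \<noteq> []" "rudin_shapiro_morphism c \<noteq> []"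
    "period_doubling_morphism c \<noteq> []" "fibonacci_morphism c \<noteq> []" for c
    by (cases c; simp add: rudin_shapiro_morphism_def)+
  show "thue_morse 0 = 0" "is_fixed_point thue_morse_morphism thue_morse"
    using fixed_point_props[of thue_morse_morphism 0 "[1]"] ne
    by (simp_all add: thue_morse_def)
  show "fixed_point rudin_shapiro_morphism 0 0 = 0"
    "is_fixed_point rudin_shapiro_morphism (fixed_point rudin_shapiro_morphism 0)"
    using fixed_point_props[of rudin_shapiro_morphism 0 "[1]"] ne
    by (simp_all add: rudin_shapiro_morphism_def)
  show "period_doubling 0 = 1" "is_fixed_point period_doubling_morphism period_doubling"
    using fixed_point_props[of period_doubling_morphism 1 "[0]"] ne
    by (simp_all add: period_doubling_def)
  show "fibonacci_word 0 = 0" "is_fixed_point fibonacci_morphism fibonacci_word"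
    using fixed_point_props[of fibonacci_morphism 0 "[1]"] ne
    by (simp_all add: fibonacci_word_def)
qed

section \<open>Automata over base-2 representations\<close>

text \<open>The bits 1 and 0 are \<open>True\<close> and \<open>False\<close>. The transition function is partial: a missing
  transition (\<open>None\<close>) rejects.\<close>

record 'q dfa =
  states :: "'q set"
  start :: 'q
  finals :: "'q set"
  delta :: "'q \<Rightarrow> bool \<Rightarrow> 'q option"

definition is_dfa :: "'q dfa \<Rightarrow> bool" where
  "is_dfa M \<longleftrightarrow> finite (states M) \<and> start M \<in> states M \<and> finals M \<subseteq> states M \<and>
     (\<forall>q \<in> states M. \<forall>b q'. delta M q b = Some q' \<longrightarrow> q' \<in> states M)"

fun run :: "'q dfa \<Rightarrow> 'q \<Rightarrow> bool list \<Rightarrow> 'q option" where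
  "run M q [] = Some q"
| "run M q (b # w) = (case delta M q b of None \<Rightarrow> None | Some q' \<Rightarrow> run M q' w)"

definition accepts :: "'q dfa \<Rightarrow> bool list \<Rightarrow> bool" where
  "accepts M w \<longleftrightarrow> (\<exists>q \<in> finals M. run M (start M) w = Some q)"

text \<open>The representation has no leading zeros and starts with the most significant bit; in
  particular the representation of 0 is the empty word.\<close>

fun base2 :: "nat \<Rightarrow> bool list" where
  "base2 n = (if n = 0 then [] else base2 (n div 2) @ [odd n])"

declare base2.simps [simp del]

text \<open>States may be taken to be natural numbers, since every finite set of states can be renamed
  into the natural numbers.\<close>

definition dfa_with_states_accepting :: "nat \<Rightarrow> (nat \<Rightarrow> bool) \<Rightarrow> bool" where
  "dfa_with_states_accepting k P \<longleftrightarrow>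
     (\<exists>M :: nat dfa. is_dfa M \<and> card (states M) = k \<and> (\<forall>n. accepts M (base2 n) \<longleftrightarrow> P n))"

end

theory Submission
  imports Defs
begin

text \<open>
  A word of length \<open>n \<ge> 2\<close> is closed iff it is a complete first return of a factor \<open>w\<close>: \<open>n = p + |w|\<close>,
  where \<open>p\<close> is the distance from an occurrence of \<open>w\<close> to the next one. If such a return sits inside
  a longer run of period \<open>p\<close>, all intermediate lengths are closed too.

  A word whose period \<open>p\<close> satisfies \<open>2p \<le> n + 1\<close> is closed by the theorem of Fine and Wilf. The
  period-doubling and Fibonacci words have runs of exponent large enough to reach every length in
  this way.

  For the other three sequences, long windows can only agree at even distances (at multiples of 4 for
  Rudin-Shapiro and paperfolding), and then agreement at distance \<open>2d\<close> is agreement of the halved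
  windows at distance \<open>d\<close>. Hence first returns scale by 2, and finitely many of them generate the
  closed lengths. Conversely, for Rudin-Shapiro and paperfolding, a window longer than about \<open>2^j\<close>
  has returns only at multiples of \<open>2^(j+1)\<close>, while a shorter window returns early. Together
  these rule out the lengths from just above (or at) \<open>2^k\<close> to about \<open>2^k + 2^(k-5)\<close> and
  \<open>2^k + 2^(k-4)\<close>, respectively; apart from these only 35, 67 and 18 are missing.
\<close>

section \<open>Closed factors and first returns\<close>

text \<open>Excluded lengths: let K be \<open>2 ^ (k - 5)\<close> for Rudin-Shapiro and
  \<open>2 ^ (k - 4)\<close> for paperfolding. For a window of m letters with m at most about K, the
  early return keeps p + m below 2^k. For longer ones p < 2^k, and some power of two that is at
  least m divides p. It also divides 2^k, so the gap 2^k - p is at least m and p + m cannot pass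
  2^k. The obstacle is parity. For these two sequences the letter at x also depends on the parity of
  x div 2, so agreement at distance 2d halves cleanly only for even d, and evenness is carried
  through every return. Odd distances are impossible for windows of 8 (Rudin-Shapiro) or 7
  (paperfolding) letters, but do occur for shorter ones. The few pairs (p, m) left open are refuted
  for all positions at once by searching finite models: two adjacent blocks, of which there are four
  kinds up to complementation, or eight kinds. Positive families use windows from c 2^j - 1 to e 2^j
  + 1 or e 2^j. Halving sends such endpoints to those for j - 1, so only the smallest j needs
  evaluation.\<close>

definition matches :: "(nat \<Rightarrow> 'a) \<Rightarrow> nat \<Rightarrow> nat \<Rightarrow> nat \<Rightarrow> bool" where
  "matches u d a b \<longleftrightarrow> (\<forall>x. a \<le> x \<longrightarrow> x < b \<longrightarrow> u x = u (x + d))"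

definition first_return :: "(nat \<Rightarrow> 'a) \<Rightarrow> nat \<Rightarrow> nat \<Rightarrow> nat \<Rightarrow> bool" where
  "first_return u p a b \<longleftrightarrow> 0 < p \<and> a < b \<and> matches u p a b \<and>
     (\<forall>d. 0 < d \<longrightarrow> d < p \<longrightarrow> \<not> matches u d a b)"

lemma matches_mono: "matches u d a b \<Longrightarrow> a \<le> a' \<Longrightarrow> b' \<le> b \<Longrightarrow> matches u d a' b'"
  unfolding matches_def by auto

text \<open>A smaller shift of the larger window would restrict to one of the smaller window, so
  minimality of p survives; only the match at p itself must be supplied.\<close>

lemma first_return_extend:
  assumes "first_return u p a b" "matches u p a' b'" "a' \<le> a" "b \<le> b'"
  shows "first_return u p a' b'"
  using assms matches_mono[of u _ a' b' a b] unfolding first_return_def by auto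

lemma occurrence_iff_matches:
  fixes u :: "nat \<Rightarrow> 'a"
  assumes x: "x = map u [a..<a + n]" and m: "m \<le> n"
  shows "d + m \<le> n \<and> take m (drop d x) = take m x \<longleftrightarrow> d + m \<le> n \<and> matches u d a (a + m)"
proof -
  have "take m (drop d x) = take m x \<longleftrightarrow> matches u d a (a + m)" if "d + m \<le> n"
  proof -
    have "take m (drop d x) = map u [a + d..<a + d + m]"
      using that by (simp add: x drop_map take_map add.assoc)
    moreover have "take m x = map u [a..<a + m]" using m by (simp add: x take_map)
    moreover have "map u [a + d..<a + d + m] = map u [a..<a + m] \<longleftrightarrow>
        (\<forall>i<m. u (a + d + i) = u (a + i))"
      by (simp add: list_eq_iff_nth_eq)
    moreover have "\<dots> \<longleftrightarrow> matches u d a (a + m)"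
    proof
      assume *: "\<forall>i<m. u (a + d + i) = u (a + i)"
      show "matches u d a (a + m)" unfolding matches_def
      proof (intro allI impI)
        fix y assume "a \<le> y" "y < a + m"
        then show "u y = u (y + d)" using *[rule_format, of "y - a"] by (simp add: add.commute)
      qed
    next
      assume *: "matches u d a (a + m)"
      show "\<forall>i<m. u (a + d + i) = u (a + i)"
        using * unfolding matches_def by (metis add.assoc add.commute le_add1 nat_add_left_cancel_less)
    qed
    ultimately show ?thesis by simp
  qed
  then show ?thesis by blast
qed

text \<open>A border of length m of a word of length n always occurs at 0 and at n - m. Exactly two
  occurrences means that no shift strictly between works, which is minimality of p = n - m. This
  moves the whole problem from words to shifts of windows.\<close>

lemma has_closed_factor_iff:
  "has_closed_factor u n \<longleftrightarrow> n \<le> 1 \<or> (\<exists>a b p. first_return u p a b \<and> n = p + (b - a))"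
proof
  assume "has_closed_factor u n"
  then obtain a x where x: "x = map u [a..<a + n]" and c: "closed_word x"
    unfolding has_closed_factor_def factor_def by auto
  show "n \<le> 1 \<or> (\<exists>a b p. first_return u p a b \<and> n = p + (b - a))"
  proof (cases "n \<le> 1")
    case False
    then obtain w where w: "border w x" and o: "occurrences w x = 2"
      using c x unfolding closed_word_def by auto
    define m where "m = length w"
    have "length w \<le> length x"
      using w unfolding border_def by (blast dest: prefix_length_le)
    then have wm: "w = take m x" "m > 0" "m \<le> n"
      using w x unfolding border_def m_def by (auto simp: prefix_def)
    let ?S = "{i. i + m \<le> n \<and> matches u i a (a + m)}"
    have S: "{i. i + length w \<le> length x \<and> take (length w) (drop i x) = w} = ?S"
    proof (rule Collect_cong)
      fix i
      have "length x = n" using x by simp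
      then show "(i + length w \<le> length x \<and> take (length w) (drop i x) = w) \<longleftrightarrow>
          (i + m \<le> n \<and> matches u i a (a + m))"
        using occurrence_iff_matches[OF x wm(3), of i] wm(1)[symmetric] m_def by simp
    qed
    have o2: "card ?S = 2" using o S unfolding occurrences_def by simp
    have "0 \<in> ?S" using wm by (simp add: matches_def)
    moreover have "n - m \<in> ?S"
    proof -
      have "drop (length x - length w) x = w"
        using w unfolding border_def suffix_def by auto
      moreover have "length x = n" using x by simp
      ultimately have "drop (n - m) x = w" using m_def by metis
      then have "n - m \<in> {i. i + length w \<le> length x \<and> take (length w) (drop i x) = w}"
        using wm(3) \<open>length x = n\<close> m_def by simp
      then show ?thesis using S by simp
    qed
    moreover have "m \<noteq> n"
    proof
      assume "m = n"
      then have "?S \<subseteq> {0}" by auto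
      then have "card ?S \<le> card {0 :: nat}" by (intro card_mono) auto
      then show False using o2 by simp
    qed
    ultimately have S2: "?S = {0, n - m}"
    proof -
      have "finite ?S" by (rule finite_subset[of _ "{..n}"]) auto
      moreover have "{0, n - m} \<subseteq> ?S" using \<open>0 \<in> ?S\<close> \<open>n - m \<in> ?S\<close> by simp
      moreover have "card {0, n - m} = 2" using \<open>m \<noteq> n\<close> wm by simp
      ultimately show ?thesis using o2 card_subset_eq by metis
    qed
    have "first_return u (n - m) a (a + m)"
      unfolding first_return_def
    proof (intro conjI allI impI)
      show "0 < n - m" using \<open>m \<noteq> n\<close> wm by simp
      show "a < a + m" using wm by simp
      show "matches u (n - m) a (a + m)" using S2 by blast
      fix d assume "0 < d" "d < n - m"
      then have "d \<notin> ?S" using S2 by simp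
      then show "\<not> matches u d a (a + m)" using \<open>d < n - m\<close> by simp
    qed
    moreover have "n = (n - m) + ((a + m) - a)" using wm by simp
    ultimately show ?thesis by blast
  qed simp
next
  assume *: "n \<le> 1 \<or> (\<exists>a b p. first_return u p a b \<and> n = p + (b - a))"
  show "has_closed_factor u n"
  proof (cases "n \<le> 1")
    case True
    then show ?thesis unfolding has_closed_factor_def closed_word_def factor_def
      by (intro exI[of _ "map u [0..<n]"]) (auto intro!: exI[of _ 0])
  next
    case False
    then obtain a b p where r: "first_return u p a b" and n: "n = p + (b - a)" using * by auto
    define m where "m = b - a"
    have m: "m > 0" "m \<le> n" "b = a + m" "p > 0" "n = p + m"
      using r n unfolding first_return_def m_def by auto
    define x where "x = map u [a..<a + n]"
    define w where "w = take m x"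
    let ?S = "{i. i + m \<le> n \<and> matches u i a (a + m)}"
    have lw: "length w = m" using m by (simp add: w_def x_def)
    have S: "{i. i + length w \<le> length x \<and> take (length w) (drop i x) = w} = ?S"
    proof (rule Collect_cong)
      fix i
      have "length x = n" by (simp add: x_def)
      then show "(i + length w \<le> length x \<and> take (length w) (drop i x) = w) \<longleftrightarrow>
          (i + m \<le> n \<and> matches u i a (a + m))"
        using occurrence_iff_matches[OF x_def m(2), of i] lw w_def[symmetric] by simp
    qed
    have mp: "matches u p a (a + m)" using r m unfolding first_return_def by simp
    have S2: "?S = {0, p}"
    proof (intro equalityI subsetI)
      fix i assume i: "i \<in> ?S"
      then have "i \<le> p" using m by simp
      then show "i \<in> {0, p}" using i r m unfolding first_return_def
        by (metis (no_types, lifting) insert_iff le_neq_implies_less mem_Collect_eq neq0_conv)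
    qed (use mp m in \<open>auto simp: matches_def\<close>)
    have "occurrences w x = 2" unfolding occurrences_def S S2 using m by simp
    moreover have "border w x" unfolding border_def
    proof (intro conjI)
      show "w \<noteq> []" using lw m by auto
      show "prefix w x" by (simp add: w_def take_is_prefix)
      have "p \<in> {i. i + length w \<le> length x \<and> take (length w) (drop i x) = w}"
        unfolding S S2 by simp
      then have "take m (drop p x) = w" using lw by simp
      moreover have "take m (drop p x) = drop p x" using m by (simp add: x_def)
      ultimately show "suffix w x" by (metis suffix_drop)
    qed
    moreover have "factor x u" "length x = n" unfolding factor_def x_def by auto
    ultimately show ?thesis unfolding has_closed_factor_def closed_word_def by blast
  qed
qed

text \<open>The window can be enlarged letter by letter inside the run of period p without losing
  the first return, so one return yields a whole interval of lengths.\<close>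

lemma has_closed_factor_range:
  assumes "first_return u p a b" "matches u p a' b'" "a' \<le> a" "b \<le> b'"
    and n: "p + (b - a) \<le> n" "n \<le> p + (b' - a')"
  shows "has_closed_factor u n"
proof -
  have ab: "a < b" using assms(1) by (simp add: first_return_def)
  define k where "k = n - p"
  \<comment> \<open>The window of k letters starts at a, and moves left only as far as it would
    stick out of the run at b'.\<close>
  define l where "l = min a (b' - k)"
  have "l \<le> a" "a' \<le> l" "b \<le> l + k" "l + k \<le> b'"
    using assms ab unfolding l_def k_def by auto
  then have "first_return u p l (l + k)"
    using first_return_extend[OF assms(1)] matches_mono[OF assms(2)] by blast
  then show ?thesis unfolding has_closed_factor_iff using n k_def
    by (intro disjI2 exI[of _ l] exI[of _ "l + k"] exI[of _ p]) auto
qed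

text \<open>Only equality of letters matters, so binary sequences may be handled as predicates,
  whose letters the simplifier computes as truth values.\<close>

lemma has_closed_factor_of_bool:
  "has_closed_factor (\<lambda>n. of_bool (v n) :: nat) = has_closed_factor v"
proof -
  have "matches (\<lambda>n. of_bool (v n) :: nat) = matches v" 
    by (intro ext) (simp add: matches_def of_bool_eq_iff)
  then show ?thesis by (intro ext) (simp add: has_closed_factor_iff first_return_def)
qed

section \<open>Words with a period, and the theorem of Fine and Wilf\<close>

lemma period_mod:
  assumes "matches u p a (a + (N - p))" "x < N" "0 < p"
  shows "u (a + x) = u (a + x mod p)"
  using assms(2)
proof (induction x rule: less_induct)
  case (less x)
  show ?case
  proof (cases "x < p")
    case False
    then have "u (a + (x - p)) = u (a + (x - p) mod p)"
      by (intro less.IH) (use less.prems assms(3) in auto)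
    moreover have "u (a + (x - p)) = u (a + (x - p) + p)"
      using assms(1) False less.prems unfolding matches_def by auto
    moreover have "a + (x - p) + p = a + x" "(x - p) mod p = x mod p"
      using False by (auto simp: le_mod_geq)
    ultimately show ?thesis by simp
  qed simp
qed

lemma period_of_mod:
  assumes "\<And>x. x < N \<Longrightarrow> u (a + x) = u (a + x mod p)"
  shows "matches u p a (a + (N - p))"
  unfolding matches_def
proof (intro allI impI)
  fix x assume x: "a \<le> x" "x < a + (N - p)"
  then have "u (a + (x - a)) = u (a + (x - a) mod p)"
    and "u (a + (x - a + p)) = u (a + (x - a + p) mod p)"
    by (intro assms; use x in simp)+
  moreover have "(x - a + p) mod p = (x - a) mod p" by simp
  moreover have "a + (x - a + p) = x + p" using x by simp
  moreover have "a + (x - a) = x" using x by simp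
  ultimately show "u x = u (x + p)" by metis
qed

text \<open>Subtractive Euclid: for q < p the prefix of length N - q has the periods p - q and q,
  hence by induction g = gcd p q. Period q then carries g to the whole word.\<close>

lemma fine_wilf:
  assumes "0 < p" "0 < q" "p + q \<le> N + gcd p q"
    "matches u p a (a + (N - p))" "matches u q a (a + (N - q))"
  shows "matches u (gcd p q) a (a + (N - gcd p q))"
  using assms
proof (induction "p + q" arbitrary: p q N rule: less_induct)
  case less
  have main: "matches u (gcd p q) a (a + (N - gcd p q))"
    if qp: "q < p" and "0 < q" and N: "p + q \<le> N + gcd p q"
      and mp: "matches u p a (a + (N - p))" and mq: "matches u q a (a + (N - q))"
      and IH: "\<And>p' q' N. p' + q' < p + q \<Longrightarrow> 0 < p' \<Longrightarrow> 0 < q' \<Longrightarrow> p' + q' \<le> N + gcd p' q' \<Longrightarrow>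
        matches u p' a (a + (N - p')) \<Longrightarrow> matches u q' a (a + (N - q')) \<Longrightarrow>
        matches u (gcd p' q') a (a + (N - gcd p' q'))" for p q N
  proof -
    let ?g = "gcd p q"
    have g: "gcd (p - q) q = ?g" using qp by (simp add: gcd_diff1_nat)
    have "?g dvd p - q" by (simp add: dvd_diff_nat)
    then have "?g \<le> p - q" using qp by (simp add: dvd_imp_le)
    \<comment> \<open>From p + q <= N + g and g <= p - q. So the first q letters, to which period q
      reduces every letter, lie in the prefix that has period g.\<close>
    then have q: "q \<le> N - q" using N qp by linarith
    have "matches u (p - q) a (a + (N - q - (p - q)))"
      unfolding matches_def
    proof (intro allI impI)
      fix x assume x: "a \<le> x" "x < a + (N - q - (p - q))"
      have "u x = u (x + p)" using mp x qp unfolding matches_def by simp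
      moreover have "u (x + (p - q)) = u (x + (p - q) + q)"
        using mq x qp unfolding matches_def by simp
      ultimately show "u x = u (x + (p - q))" using qp by simp
    qed
    moreover have "matches u q a (a + (N - q - q))" using mq by (rule matches_mono) auto
    ultimately have mg: "matches u ?g a (a + (N - q - ?g))"
      using IH[of "p - q" q "N - q"] g qp \<open>0 < q\<close> N by simp
    show ?thesis
    proof (rule period_of_mod)
      fix x assume x: "x < N"
      have "u (a + x) = u (a + x mod q)" by (rule period_mod[OF mq x \<open>0 < q\<close>])
      also have "\<dots> = u (a + x mod q mod ?g)"
        by (rule period_mod[OF mg]) (use q \<open>0 < q\<close> in \<open>auto intro: less_le_trans[OF mod_less_divisor]\<close>)
      finally show "u (a + x) = u (a + x mod ?g)" by (simp add: mod_mod_cancel)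
    qed
  qed
  show ?case
  proof (cases p q rule: linorder_cases)
    case less
    then show ?thesis using main[of p q N] main[of q p N] less.prems less.hyps
      by (simp add: gcd.commute add.commute)
  next
    case equal
    then show ?thesis using less.prems by simp
  next
    case greater
    then show ?thesis using main[of q p N] less.prems less.hyps by simp
  qed
qed

text \<open>The border comes from the least period q of the word of length N = p + m, not from p. An
  earlier return at d < q would give a prefix with periods d and q, long enough for Fine and Wilf
  because 2q <= N + 1; then gcd d q < q would be a period of the whole word.\<close>

lemma has_closed_factor_periodic:
  assumes "0 < p" "matches u p a (a + m)" "p \<le> Suc m" "0 < m"
  shows "has_closed_factor u (p + m)"
proof -
  define N where "N = p + m"
  let ?P = "\<lambda>p. 0 < p \<and> matches u p a (a + (N - p))"
  define q where "q = (LEAST p. ?P p)"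
  have "?P p" using assms by (simp add: N_def)
  then have Pq: "?P q" and "q \<le> p" unfolding q_def by (rule LeastI, rule Least_le)
  have min: "q \<le> d" if "?P d" for d unfolding q_def by (rule Least_le) (rule that)
  have q2: "2 * q \<le> Suc N" "q < N" using \<open>q \<le> p\<close> assms by (auto simp: N_def)
  have "first_return u q a (a + (N - q))"
    unfolding first_return_def
  proof (intro conjI allI impI)
    fix d assume d: "0 < d" "d < q"
    show "\<not> matches u d a (a + (N - q))"
    proof
      assume md: "matches u d a (a + (N - q))"
      let ?g = "gcd d q"
      have g: "?g dvd q" "0 < ?g" "?g \<le> d" using d by (auto intro: dvd_imp_le)
      \<comment> \<open>Agreement at distance d of a window of N - q letters is period d of the
        prefix of length d + (N - q), which is shorter than N and so inherits period q.\<close>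
      have "matches u ?g a (a + (d + (N - q) - ?g))"
      proof (rule fine_wilf)
        show "matches u d a (a + (d + (N - q) - d))" using md by simp
        have "d + (N - q) - q \<le> N - q" using d by simp
        then show "matches u q a (a + (d + (N - q) - q))"
          using Pq by (auto elim: matches_mono)
        have "Suc 0 \<le> ?g" using g(2) by linarith
        then show "d + q \<le> d + (N - q) + ?g" using q2 by linarith
      qed (use d in auto)
      then have *: "u (a + x) = u (a + x mod ?g)" if "x < d + (N - q)" for x
        using period_mod[OF _ that g(2)] by blast
      have "matches u ?g a (a + (N - ?g))"
      proof (rule period_of_mod)
        fix x assume x: "x < N"
        have "u (a + x) = u (a + x mod q)" using period_mod[OF _ x] Pq by blast
        also have "\<dots> = u (a + x mod q mod ?g)"
        proof (rule *)
          \<comment> \<open>The first q letters lie in that prefix: 2q <= N + 1 and d >= 1.\<close>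
          have "x mod q < q" using Pq by simp
          then show "x mod q < d + (N - q)" using q2 d by linarith
        qed
        finally show "u (a + x) = u (a + x mod ?g)" using g by (simp add: mod_mod_cancel)
      qed
      then have "q \<le> ?g" using g min by simp
      then show False using g d by simp
    qed
  qed (use Pq q2 in auto)
  then show ?thesis unfolding has_closed_factor_iff using q2
    by (intro disjI2 exI[of _ a] exI[of _ "a + (N - q)"] exI[of _ q]) (simp add: N_def)
qed

section \<open>Evaluation on concrete windows, halving of windows, 2-uniform morphisms\<close>

lemma matches_code: "matches u d a b \<longleftrightarrow> list_all (\<lambda>x. u x = u (x + d)) [a..<b]"
  by (auto simp: matches_def list_all_iff)

lemma first_return_code:
  "first_return u p a b \<longleftrightarrow>
     0 < p \<and> a < b \<and> matches u p a b \<and> list_all (\<lambda>d. \<not> matches u d a b) [1..<p]"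
  by (auto simp: first_return_def list_all_iff)

lemma upt_eval:
  "[0..<numeral k] = 0 # [Suc 0..<numeral k]"
  "[Suc 0..<numeral k] = (if (1 :: nat) < numeral k then Suc 0 # [2..<numeral k] else [])"
  "[numeral l..<numeral k] =
    (if (numeral l :: nat) < numeral k then numeral l # [Suc (numeral l)..<numeral k] else [])"
  by (subst upt_rec; simp add: numeral_2_eq_2)+

text \<open>Halving maps the nonempty interval from a to b onto the one from a div 2 to (b + 1) div
  2: each such y has 2y or 2y + 1 in the window, the latter being needed only when a = 2y +
  1.\<close>

lemma ball_window_half:
  fixes a b :: nat
  assumes "a < b"
  shows "(\<forall>x. a \<le> x \<longrightarrow> x < b \<longrightarrow> P (x div 2)) \<longleftrightarrow>
    (\<forall>y. a div 2 \<le> y \<longrightarrow> y < (b + 1) div 2 \<longrightarrow> P y)"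
proof (intro iffI allI impI)
  fix y assume *: "\<forall>x. a \<le> x \<longrightarrow> x < b \<longrightarrow> P (x div 2)" and y: "a div 2 \<le> y" "y < (b + 1) div 2"
  show "P y"
  proof (cases "a \<le> 2 * y")
    case True
    then show ?thesis using *[rule_format, of "2 * y"] y by auto
  next
    case False
    then show ?thesis using *[rule_format, of "2 * y + 1"] y assms by auto
  qed
next
  fix x assume *: "\<forall>y. a div 2 \<le> y \<longrightarrow> y < (b + 1) div 2 \<longrightarrow> P y" and "a \<le> x" "x < b"
  then show "P (x div 2)" by auto
qed

lemma uniform_fixed_point:
  assumes fp: "is_fixed_point h u" and h: "\<And>c. length (h c) = 2"
  shows "u (2 * n) = h (u n) ! 0" "u (2 * n + 1) = h (u n) ! 1"
proof -
  have len: "length (morph h x) = 2 * length x" for x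
    by (induction x) (simp_all add: morph_def h)
  have "morph h (map u [0..<n]) @ h (u n) = morph h (map u [0..<Suc n])"
    by (simp add: morph_def)
  also have "\<dots> = map u [0..<2 * Suc n]"
    using fp len[of "map u [0..<Suc n]"] unfolding is_fixed_point_def by (metis length_map length_upt minus_nat.diff_0)
  finally have *: "morph h (map u [0..<n]) @ h (u n) = map u [0..<2 * Suc n]" .
  have "(morph h (map u [0..<n]) @ h (u n)) ! (2 * n + i) = h (u n) ! i" for i
    using len[of "map u [0..<n]"] by (simp add: nth_append)
  then have **: "map u [0..<2 * Suc n] ! (2 * n + i) = h (u n) ! i" for i by (simp add: *)
  show "u (2 * n) = h (u n) ! 0" using **[of 0] by (simp del: upt_Suc)
  show "u (2 * n + 1) = h (u n) ! 1" using **[of 1] by (simp del: upt_Suc)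
qed

lemma power_of_2_between:
  assumes "0 < (n :: nat)"
  obtains k where "2 ^ k \<le> n" "n < 2 * 2 ^ k"
  using ex_power_ivl1[of 2 n] assms by (auto simp: mult.commute)

section \<open>The Thue-Morse sequence\<close>

definition tm :: "nat \<Rightarrow> bool" where
  "tm n \<longleftrightarrow> thue_morse n = 1"

lemma length_thue_morse_morphism: "length (thue_morse_morphism c) = 2"
  by (cases c) auto

lemmas thue_morse_rec =
  uniform_fixed_point[OF fixed_point_sequences(2) length_thue_morse_morphism]

lemma thue_morse_less_2: "thue_morse n < 2"
proof (induction n rule: less_induct)
  case (less n)
  have "thue_morse n = thue_morse_morphism (thue_morse (n div 2)) ! (n mod 2)"
    using thue_morse_rec[of "n div 2"] by (cases "even n") (auto elim!: evenE oddE)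
  also have "\<dots> < 2" by (cases "thue_morse (n div 2)"; cases "even n") (auto elim!: evenE oddE)
  finally show ?case .
qed

lemma thue_morse_eq: "thue_morse = (\<lambda>n. of_bool (tm n))"
proof
  fix n
  show "thue_morse n = of_bool (tm n)" using thue_morse_less_2[of n] by (auto simp: tm_def)
qed

lemma tm_rec: "tm (2 * n) \<longleftrightarrow> tm n" "tm (2 * n + 1) \<longleftrightarrow> \<not> tm n" "\<not> tm 0"
proof -
  have "thue_morse n = 0 \<or> thue_morse n = 1" using thue_morse_less_2[of n] by auto
  then show "tm (2 * n) \<longleftrightarrow> tm n" "tm (2 * n + 1) \<longleftrightarrow> \<not> tm n"
    unfolding tm_def thue_morse_rec by auto
  show "\<not> tm 0" by (simp add: tm_def fixed_point_sequences)
qed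

lemma tm_numeral [simp]:
  "tm (numeral (Num.Bit0 k)) \<longleftrightarrow> tm (numeral k)"
  "tm (numeral (Num.Bit1 k)) \<longleftrightarrow> \<not> tm (numeral k)"
  "tm 1" "tm (Suc 0)" "tm (Suc (Suc 0))" "\<not> tm (Suc (Suc (Suc 0)))" "\<not> tm 0"
proof -
  show "tm (numeral (Num.Bit0 k)) \<longleftrightarrow> tm (numeral k)"
    using tm_rec(1)[of "numeral k"] by simp
  show "tm (numeral (Num.Bit1 k)) \<longleftrightarrow> \<not> tm (numeral k)"
    using tm_rec(2)[of "numeral k"] by simp
  show "tm 1" "tm (Suc 0)" "tm (Suc (Suc 0))" "\<not> tm (Suc (Suc (Suc 0)))" "\<not> tm 0"
    using tm_rec(2)[of 0] tm_rec(1)[of 1] tm_rec(2)[of 1] tm_rec(3) by (simp_all add: numeral_2_eq_2)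
qed

lemma tm_div: "tm x \<longleftrightarrow> (tm (x div 2) \<noteq> odd x)"
  using tm_rec(1,2)[of "x div 2"] by (cases "even x") (auto elim!: evenE oddE)

lemma tm_matches_double:
  assumes "a < b"
  shows "matches tm (2 * d) a b \<longleftrightarrow> matches tm d (a div 2) ((b + 1) div 2)"
proof -
  have "tm x = tm (x + 2 * d) \<longleftrightarrow> tm (x div 2) = tm (x div 2 + d)" for x
  proof -
    have "(x + 2 * d) div 2 = x div 2 + d" "odd (x + 2 * d) \<longleftrightarrow> odd x" by auto
    then show ?thesis using tm_div[of x] tm_div[of "x + 2 * d"] by metis
  qed
  then show ?thesis unfolding matches_def using ball_window_half[OF assms] by simp
qed

text \<open>Five consecutive positions include some 4z + 1, 4z + 2, which carry equal letters. An
  odd shift moves them to a pair 2w, 2w + 1, whose letters always differ.\<close>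

lemma tm_matches_even:
  assumes "matches tm d a b" "a + 5 \<le> b"
  shows "even d"
proof (rule ccontr)
  assume odd: "odd d"
  define z where "z = (a + 2) div 4"
  define w where "w = (4 * z + 1 + d) div 2"
  have z: "a \<le> 4 * z + 1" "4 * z + 2 < b" using assms(2) unfolding z_def by linarith+
  have w: "4 * z + 1 + d = 2 * w" "4 * z + 2 + d = 2 * w + 1"
    using odd unfolding w_def by presburger+
  have "tm (4 * z + 1) = tm (4 * z + 2)"
    using tm_rec(2)[of "2 * z"] tm_rec(1)[of "2 * z + 1"] tm_rec(2)[of z] tm_rec(1)[of z]
    by simp
  moreover have "tm (4 * z + 1) = tm (2 * w)" "tm (4 * z + 2) = tm (2 * w + 1)"
    using assms(1) z unfolding matches_def w[symmetric] by auto
  ultimately show False using tm_rec(1,2)[of w] by simp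
qed

text \<open>Gives the lengths from 9 2^j + 2 to 16 2^j. \<open>tm_family2\<close> gives those from 8
  2^j + 1 to 10 2^j, so together they fill the interval above 8 2^j up to 16 2^j.\<close>

lemma tm_family1:
  shows "first_return tm (8 * 2 ^ j) (9 * 2 ^ j - 1) (10 * 2 ^ j + 1)"
    and "matches tm (8 * 2 ^ j) (8 * 2 ^ j) (16 * 2 ^ j)"
proof (induction j)
  case 0
  show "first_return tm (8 * 2 ^ 0) (9 * 2 ^ 0 - 1) (10 * 2 ^ 0 + 1)"
    and "matches tm (8 * 2 ^ 0) (8 * 2 ^ 0) (16 * 2 ^ 0)"
    by (simp_all add: first_return_code matches_code upt_eval)
next
  case (Suc j)
  have half: "(9 * 2 ^ Suc j - 1 :: nat) div 2 = 9 * 2 ^ j - 1"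
    "(10 * 2 ^ Suc j + 1 + 1 :: nat) div 2 = 10 * 2 ^ j + 1" by auto
  have lt: "(9 * 2 ^ j - 1 :: nat) < 10 * 2 ^ j + 1" for j by (simp add: less_Suc_eq_le)
  show "matches tm (8 * 2 ^ Suc j) (8 * 2 ^ Suc j) (16 * 2 ^ Suc j)"
    using Suc(2) tm_matches_double[of "8 * 2 ^ Suc j" "16 * 2 ^ Suc j" "8 * 2 ^ j"] by simp
  have eq: "matches tm (2 * d) (9 * 2 ^ Suc j - 1) (10 * 2 ^ Suc j + 1) \<longleftrightarrow>
      matches tm d (9 * 2 ^ j - 1) (10 * 2 ^ j + 1)" for d
    unfolding tm_matches_double[OF lt] half ..
  show "first_return tm (8 * 2 ^ Suc j) (9 * 2 ^ Suc j - 1) (10 * 2 ^ Suc j + 1)"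
  \<comment> \<open>For exponent 1 the window has 4 letters, one too few for
    \<open>tm_matches_even\<close>, so this case is evaluated as well.\<close>
  proof (cases "j = 0")
    case True
    then show ?thesis by (simp add: first_return_code matches_code upt_eval)
  next
    case False
    then have j: "2 \<le> (2 :: nat) ^ j" by (cases j) auto
    show ?thesis
      unfolding first_return_def
    proof (intro conjI allI impI)
      show "matches tm (8 * 2 ^ Suc j) (9 * 2 ^ Suc j - 1) (10 * 2 ^ Suc j + 1)"
        using Suc(1) eq[of "8 * 2 ^ j"] by (simp add: first_return_def)
      fix d :: nat assume d: "0 < d" "d < 8 * 2 ^ Suc j"
      show "\<not> matches tm d (9 * 2 ^ Suc j - 1) (10 * 2 ^ Suc j + 1)"
      proof
        assume m: "matches tm d (9 * 2 ^ Suc j - 1) (10 * 2 ^ Suc j + 1)"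
        then have "even d" by (rule tm_matches_even) (use j in simp)
        then obtain e where "d = 2 * e" by (rule evenE)
        then show False using m eq[of e] Suc(1) d by (simp add: first_return_def)
      qed
    qed (use lt in auto)
  qed
qed

lemma tm_family2:
  shows "first_return tm (6 * 2 ^ j) 0 (2 * 2 ^ j + 1)"
    and "matches tm (6 * 2 ^ j) 0 (4 * 2 ^ j)"
proof (induction j)
  case 0
  show "first_return tm (6 * 2 ^ 0) 0 (2 * 2 ^ 0 + 1)"
    and "matches tm (6 * 2 ^ 0) 0 (4 * 2 ^ 0)"
    by (simp_all add: first_return_code matches_code upt_eval)
next
  case (Suc j)
  show "matches tm (6 * 2 ^ Suc j) 0 (4 * 2 ^ Suc j)"
    using Suc(2) tm_matches_double[of 0 "4 * 2 ^ Suc j" "6 * 2 ^ j"] by simp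
  have eq: "matches tm (2 * d) 0 (2 * 2 ^ Suc j + 1) \<longleftrightarrow> matches tm d 0 (2 * 2 ^ j + 1)" for d
    using tm_matches_double[of 0 "2 * 2 ^ Suc j + 1" d] by simp
  have j: "1 \<le> (2 :: nat) ^ j" by simp
  show "first_return tm (6 * 2 ^ Suc j) 0 (2 * 2 ^ Suc j + 1)"
    unfolding first_return_def
  proof (intro conjI allI impI)
    show "matches tm (6 * 2 ^ Suc j) 0 (2 * 2 ^ Suc j + 1)"
      using Suc(1) eq[of "6 * 2 ^ j"] by (simp add: first_return_def)
    fix d :: nat assume d: "0 < d" "d < 6 * 2 ^ Suc j"
    show "\<not> matches tm d 0 (2 * 2 ^ Suc j + 1)"
    proof
      assume m: "matches tm d 0 (2 * 2 ^ Suc j + 1)"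
      then have "even d" by (rule tm_matches_even) (use j in simp)
      then obtain e where "d = 2 * e" by (rule evenE)
      then show False using m eq[of e] Suc(1) d by (simp add: first_return_def)
    qed
  qed auto
qed

lemma tm_small: "2 \<le> n \<Longrightarrow> n \<le> 8 \<Longrightarrow> has_closed_factor tm n"
proof -
  assume "2 \<le> n" "n \<le> 8"
  moreover have "first_return tm 1 1 2" "first_return tm 3 0 1" "matches tm 3 0 2"
    "first_return tm 4 4 6" "matches tm 4 4 8"
    by (simp_all add: first_return_code matches_code upt_eval)
  moreover have "first_return tm 2 2 3"
    by (simp_all add: first_return_code matches_code upt_eval)
  moreover have "n = 2 \<or> n = 3 \<or> n = 4 \<or> n = 5 \<or> 6 \<le> n" using \<open>2 \<le> n\<close> by linarith
  ultimately show ?thesis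
    using has_closed_factor_range[of tm 1 1 2 1 2 n] has_closed_factor_range[of tm 2 2 3 2 3 n]
      has_closed_factor_range[of tm 3 0 1 0 2 n] has_closed_factor_range[of tm 4 4 6 4 8 n]
    by (auto simp: first_return_def)
qed

lemma thue_morse_closed: "has_closed_factor thue_morse n"
proof -
  have "has_closed_factor tm n"
  proof (cases "n \<le> 8")
    case True
    then show ?thesis using tm_small[of n] by (cases "n \<le> 1") (auto simp: has_closed_factor_iff)
  next
    case False
    then have "0 < (n - 1) div 8" by simp
    then obtain j where j: "2 ^ j \<le> (n - 1) div 8" "(n - 1) div 8 < 2 * 2 ^ j"
      by (rule power_of_2_between)
    then have n: "8 * 2 ^ j < n" "n \<le> 16 * 2 ^ j" using False by linarith+
    show ?thesis
    proof (cases "n \<le> 10 * 2 ^ j")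
      case True
      then show ?thesis
        using has_closed_factor_range[OF tm_family2(1) tm_family2(2)[of j], of n] n by simp
    next
      case False
      moreover have "9 * 2 ^ j - 1 + (2 + 2 ^ j) = 10 * 2 ^ j + (1 :: nat)" "0 < (2 :: nat) ^ j"
        by (simp_all)
      ultimately show ?thesis
        using has_closed_factor_range[OF tm_family1(1) tm_family1(2)[of j], of n] n by simp
    qed
  qed
  then show ?thesis by (simp add: thue_morse_eq has_closed_factor_of_bool)
qed

section \<open>The period-doubling sequence\<close>

lemma period_doubling_rec:
  "period_doubling (2 * n) = 1"
  "period_doubling (2 * n + 1) = (if period_doubling n = 0 then 1 else 0)"
proof -
  have "length (period_doubling_morphism c) = 2" for c by (cases c) auto
  note rec = uniform_fixed_point[OF fixed_point_sequences(6) this]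
  show "period_doubling (2 * n) = 1" "period_doubling (2 * n + 1) = (if period_doubling n = 0 then 1 else 0)"
    unfolding rec by (cases "period_doubling n"; simp)+
qed

text \<open>Even positions all carry 1, so doubling only has to compare odd positions, where the
  halved run applies. The factor spanned has length 4 2^k - 1 and period 2^k, so its prefixes settle
  the lengths from 2 2^k to 4 2^k - 1.\<close>

lemma period_doubling_matches:
  "matches period_doubling (2 ^ k) (2 * 2 ^ k) (5 * 2 ^ k - 1)"
proof (induction k)
  case 0
  have "period_doubling 2 = 1" "period_doubling 4 = 1" "period_doubling 3 = 1"
    using period_doubling_rec(1)[of 1] period_doubling_rec(1)[of 2]
      period_doubling_rec(2)[of 1] period_doubling_rec(2)[of 0] period_doubling_rec(1)[of 0]
    by simp_all
  then show ?case by (simp add: matches_code upt_eval)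
next
  case (Suc k)
  show ?case unfolding matches_def
  proof (intro allI impI)
    fix x :: nat assume x: "2 * 2 ^ Suc k \<le> x" "x < 5 * 2 ^ Suc k - 1"
    show "period_doubling x = period_doubling (x + 2 ^ Suc k)"
    proof (cases "even x")
      case True
      then obtain y where "x = 2 * y" by (rule evenE)
      then show ?thesis using period_doubling_rec(1)[of y] period_doubling_rec(1)[of "y + 2 ^ k"]
        by simp
    next
      case False
      then obtain y where y: "x = 2 * y + 1" by (rule oddE)
      then have "period_doubling y = period_doubling (y + 2 ^ k)"
        using Suc x unfolding matches_def by simp
      then show ?thesis using period_doubling_rec(2)[of y] period_doubling_rec(2)[of "y + 2 ^ k"] y
        by simp
    qed
  qed
qed

lemma period_doubling_closed: "has_closed_factor period_doubling n"
proof (cases "n \<le> 1")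
  case False
  then have "0 < n div 2" by simp
  then obtain k where "2 ^ k \<le> n div 2" "n div 2 < 2 * 2 ^ k" by (rule power_of_2_between)
  then have n: "2 * 2 ^ k \<le> n" "n \<le> 4 * 2 ^ k - 1" by linarith+
  have pos: "0 < (2 :: nat) ^ k" by simp
  have "matches period_doubling (2 ^ k) (2 * 2 ^ k) (2 * 2 ^ k + (n - 2 ^ k))"
    by (rule matches_mono[OF period_doubling_matches[of k]]) (use n in auto)
  then have "has_closed_factor period_doubling (2 ^ k + (n - 2 ^ k))"
    by (rule has_closed_factor_periodic[rotated]) (use n pos in linarith)+
  then show ?thesis using n by simp
qed (simp add: has_closed_factor_iff)

section \<open>The Fibonacci word\<close>

lemma factorI: "x = map u [i..<j] \<Longrightarrow> factor x u"
  unfolding factor_def by (cases "i \<le> j") (auto intro!: exI[of _ i])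

lemma factor_appendD:
  assumes "factor (x @ y @ z) u"
  shows "factor y u"
proof -
  obtain i where i: "x @ y @ z = map u [i..<i + length (x @ y @ z)]"
    using assms unfolding factor_def by blast
  have "y = take (length y) (drop (length x) (x @ y @ z))" by simp
  also have "\<dots> = map u [i + length x..<i + length x + length y]"
    by (subst i) (simp add: take_map drop_map)
  finally show ?thesis by (rule factorI)
qed

lemma factor_morph:
  assumes fp: "is_fixed_point h u" and x: "factor x u"
  shows "factor (morph h x) u"
proof -
  obtain i where i: "x = map u [i..<i + length x]" using x by (auto simp: factor_def)
  let ?p = "morph h (map u [0..<i])" and ?q = "morph h (map u [0..<i + length x])"
  have "map u [0..<i + length x] = map u [0..<i] @ x"
    using i upt_add_eq_append[of 0 i "length x"] by (metis map_append le0)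
  then have q: "?q = ?p @ morph h x" by (simp add: morph_append)
  have "?q = map u [0..<length ?q]" using fp by (simp add: is_fixed_point_def)
  then have "?p @ morph h x = map u [0..<length ?p + length (morph h x)]"
    unfolding q by simp
  then have "morph h x = drop (length ?p) (map u [0..<length ?p + length (morph h x)])"
    by (metis append_eq_conv_conj)
  then show ?thesis unfolding factor_def by (metis add_0 drop_map drop_upt)
qed

lemma periodic_factor_closed:
  assumes f: "factor x u" and per: "prefix (drop p x) x" and p: "0 < p"
    and n: "2 * p \<le> Suc n" "p < n" "n \<le> length x"
  shows "has_closed_factor u n"
proof -
  obtain i where i: "x = map u [i..<i + length x]" using f by (auto simp: factor_def)
  have nth: "x ! k = u (i + k)" if "k < length x" for k
    using that by (subst i) simp
  have "matches u p i (i + (n - p))"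
    unfolding matches_def
  proof (intro allI impI)
    fix y assume y: "i \<le> y" "y < i + (n - p)"
    define k where "k = y - i"
    have k: "y = i + k" "k + p < length x" using y n by (auto simp: k_def)
    have "x ! k = drop p x ! k"
      using per k by (metis add.commute length_drop less_diff_conv nth_append prefix_def)
    also have "\<dots> = x ! (k + p)" using k by (simp add: add.commute)
    finally show "u y = u (y + p)" using nth k by (simp add: add.assoc)
  qed
  then have "has_closed_factor u (p + (n - p))"
    by (rule has_closed_factor_periodic[rotated]) (use n p in auto)
  then show ?thesis using n by simp
qed

fun fib_block :: "nat \<Rightarrow> nat list" where
  "fib_block 0 = [0]"
| "fib_block (Suc 0) = [0, 1]"
| "fib_block (Suc (Suc n)) = fib_block (Suc n) @ fib_block n"

lemma morph_fib_block: "morph fibonacci_morphism (fib_block n) = fib_block (Suc n)"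
  by (induction n rule: fib_block.induct) (simp_all add: morph_append, simp_all add: morph_def)

text \<open>The morphism maps each Fibonacci block to the next one, so the pattern for j + 1 is the
  image of the pattern for j.\<close>

lemma fib_factor:
  "factor (fib_block (Suc j) @ fib_block (Suc j) @ fib_block j @ fib_block j) fibonacci_word"
proof (induction j)
  case 0
  have "map fibonacci_word [0..<13] =
      (morph fibonacci_morphism ^^ 5) [0]"
  proof -
    have "(morph fibonacci_morphism ^^ k) [0] =
       map fibonacci_word [0..<length ((morph fibonacci_morphism ^^ k) [0])]" for k
    proof (induction k)
      case (Suc k)
      then show ?case using fixed_point_sequences(8) unfolding is_fixed_point_def
        by (metis funpow_simps_right(2) comp_apply funpow_swap1)
    qed (simp add: fixed_point_sequences)
    from this[of 5] show ?thesis by (simp add: morph_def eval_nat_numeral)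
  qed
  then have *: "map fibonacci_word [0..<13] = [0, 1, 0, 0, 1, 0, 1, 0, 0, 1, 0, 0, 1]"
    by (simp add: morph_def eval_nat_numeral)
  \<comment> \<open>The base pattern 01 01 0 0 occurs at position 3.\<close>
  have "drop 3 (take 9 (map fibonacci_word [0..<13])) = [0, 1, 0, 1, 0, 0]"
    unfolding * by simp
  then have "map fibonacci_word [3..<9] = [0, 1, 0, 1, 0, 0]"
    by (simp only: take_map drop_map take_upt drop_upt) simp
  then show ?case using factorI[of _ fibonacci_word 3 9] by simp
next
  case (Suc j)
  from factor_morph[OF fixed_point_sequences(8) this] show ?case
    by (simp add: morph_append morph_fib_block)
qed

text \<open>Writing f_j for the blocks, cancelling common prefixes via f_(j+1) = f_j f_(j-1) reduces
  the claim to f_(j-2) being a prefix of f_(j-1); \<open>z\<close> is what remains of the latter.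
  For j = 0 and j = 1 the period breaks at the last letter.\<close>

lemma fib_period:
  fixes j :: nat
  defines "x \<equiv> fib_block (Suc j) @ fib_block (Suc j) @ fib_block j @ fib_block j"
  assumes "2 \<le> j"
  shows "prefix (drop (length (fib_block (Suc j))) x) x"
proof -
  obtain i where j: "j = Suc (Suc i)" using assms(2) by (metis add_2_eq_Suc le_Suc_ex)
  have "prefix (fib_block i) (fib_block (Suc i))" by (cases i) auto
  then obtain z where z: "fib_block (Suc i) = fib_block i @ z" by (auto simp: prefix_def)
  show ?thesis unfolding x_def j prefix_def
    by (rule exI[of _ "z @ fib_block i @ fib_block (Suc (Suc i))"]) (simp add: z)
qed

lemma fib_length_mono: "length (fib_block j) < length (fib_block (Suc j))"
  by (induction j rule: fib_block.induct) auto

text \<open>The upper end is 2 |f_(j+2)| and the next range starts at 2 |f_(j+2)| - 1, so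
  consecutive ranges overlap.\<close>

lemma fib_range_closed:
  assumes j: "2 \<le> j" and n: "2 * length (fib_block (Suc j)) \<le> Suc n"
    "n \<le> 2 * length (fib_block (Suc j)) + 2 * length (fib_block j)"
  shows "has_closed_factor fibonacci_word n"
proof (rule periodic_factor_closed[OF fib_factor fib_period[OF j]])
  have "0 < length (fib_block j)" by (induction j rule: fib_block.induct) auto
  then show "0 < length (fib_block (Suc j))" "length (fib_block (Suc j)) < n"
    using fib_length_mono[of j] n by linarith+
qed (use n in auto)

lemma fibonacci_closed: "has_closed_factor fibonacci_word n"
proof -
  let ?l = "\<lambda>j. length (fib_block j)"
  have small: "has_closed_factor fibonacci_word n" if "2 \<le> n" "n \<le> 9" for n
  proof -
    have f: "factor [0, 1, 0, 1, 0, 0] fibonacci_word"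
      "factor [0, 1, 0, 0, 1, 0, 0, 1, 0, 1] fibonacci_word"
      using fib_factor[of 0] fib_factor[of 1] by simp_all
    have "factor [0, 0] fibonacci_word"
      using factor_appendD[of "[0, 1, 0, 1]" "[0, 0]" "[]" fibonacci_word] f(1) by simp
    \<comment> \<open>This factor and the next are the patterns for j = 0 and j = 1 without the last
      letter, at which their periods 2 and 3 break.\<close>
    moreover have "factor [0, 1, 0, 1, 0] fibonacci_word"
      using factor_appendD[of "[]" "[0, 1, 0, 1, 0]" "[0]" fibonacci_word] f(1) by simp
    moreover have "factor [0, 1, 0, 0, 1, 0, 0, 1, 0] fibonacci_word"
      using factor_appendD[of "[]" "[0, 1, 0, 0, 1, 0, 0, 1, 0]" "[1]" fibonacci_word] f(2) by simp
    moreover have "n = 2 \<or> 3 \<le> n \<and> n \<le> 5 \<or> 6 \<le> n \<and> n \<le> 9" using that by auto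
    ultimately show ?thesis
      using periodic_factor_closed[of "[0, 0]" fibonacci_word 1 n]
        periodic_factor_closed[of "[0, 1, 0, 1, 0]" fibonacci_word 2 n]
        periodic_factor_closed[of "[0, 1, 0, 0, 1, 0, 0, 1, 0]" fibonacci_word 3 n]
      by auto
  qed
  have "has_closed_factor fibonacci_word n" if "9 \<le> n" "n \<le> 2 * ?l (j + 4)" for j
    using that
  proof (induction j)
    case 0
    have "?l (Suc 2) = 5" "?l 2 = 3" "?l 4 = 8" by (simp_all add: eval_nat_numeral)
    then show ?case using fib_range_closed[of 2 n] 0 by simp
  next
    case (Suc j)
    have l: "?l (Suc j + 4) = ?l (j + 4) + ?l (j + 3)" by (simp add: eval_nat_numeral)
    have e: "Suc (j + 3) = j + 4" by simp
    show ?case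
    proof (cases "n \<le> 2 * ?l (j + 4)")
      case False
      show ?thesis
        by (rule fib_range_closed[of "j + 3", unfolded e]) (use l False Suc.prems in linarith)+
    qed (use Suc in blast)
  qed
  note large = this
  have "j < ?l j" for j
  proof (induction j)
    case (Suc j)
    then show ?case using fib_length_mono[of j] by simp
  qed simp
  from this[of "n + 4"] show ?thesis
    using large[of n] small[of n] by (cases "n \<le> 1"; cases "n \<le> 9") (auto simp: has_closed_factor_iff)
qed

section \<open>Searching for returns\<close>

primrec agree :: "(nat \<Rightarrow> 'a) \<Rightarrow> nat \<Rightarrow> nat \<Rightarrow> nat \<Rightarrow> bool" where
  "agree f a b 0 \<longleftrightarrow> True"
| "agree f a b (Suc m) \<longleftrightarrow> (if f a = f b then agree f (Suc a) (Suc b) m else False)"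

text \<open>The stride \<open>r\<close> allows a search restricted to even distances
  (\<open>r\<close> = 2), the only ones at which returns of Rudin-Shapiro can be doubled;
  \<open>r\<close> = 1 searches all distances.\<close>

definition recurs :: "(nat \<Rightarrow> 'a) \<Rightarrow> nat \<Rightarrow> nat \<Rightarrow> nat \<Rightarrow> nat \<Rightarrow> nat \<Rightarrow> bool" where
  "recurs f m r a b e \<longleftrightarrow> (\<exists>i. b + i * r < e \<and> agree f a (b + i * r) m)"

definition all_recur :: "(nat \<Rightarrow> 'a) \<Rightarrow> nat \<Rightarrow> nat \<Rightarrow> nat \<Rightarrow> nat \<Rightarrow> nat \<Rightarrow> bool" where
  "all_recur f m r k a e \<longleftrightarrow> (\<forall>s. a \<le> s \<longrightarrow> s < e \<longrightarrow> recurs f m r s (s + r) (s + k))"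

definition no_first_return :: "(nat \<Rightarrow> 'a) \<Rightarrow> nat \<Rightarrow> nat \<Rightarrow> nat \<Rightarrow> nat \<Rightarrow> bool" where
  "no_first_return f m p a e \<longleftrightarrow>
     (\<forall>s. a \<le> s \<longrightarrow> s < e \<longrightarrow> agree f s (s + p) m \<longrightarrow> recurs f m 1 s (s + 1) (s + p))"

lemma agree_iff: "agree f a b m \<longleftrightarrow> (\<forall>i<m. f (a + i) = f (b + i))"
proof (induction m arbitrary: a b)
  case (Suc m)
  show ?case unfolding agree.simps Suc.IH by (auto simp: less_Suc_eq_0_disj)
qed simp

lemma agree_matches: "agree f a (a + d) m \<longleftrightarrow> matches f d a (a + m)"
  unfolding agree_iff matches_def by (auto simp: le_iff_add ac_simps)

text \<open>These equations unfold only at numerals, and the branches of \<open>if\<close> are not simplified before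
  its condition; so the simplifier runs the search lazily.\<close>

lemma recurs_numeral:
  "recurs f m r a (numeral b) e \<longleftrightarrow>
     (if numeral b < e then
        if agree f a (numeral b) m then True else recurs f m r a (numeral b + r) e
      else False)"
  (is "_ \<longleftrightarrow> ?R")
proof
  assume "recurs f m r a (numeral b) e"
  then obtain i where "numeral b + i * r < e" "agree f a (numeral b + i * r) m"
    unfolding recurs_def by blast
  then show ?R unfolding recurs_def by (cases i) (auto simp: ac_simps)
next
  assume R: ?R
  show "recurs f m r a (numeral b) e"
  proof (cases "agree f a (numeral b) m")
    case True
    then show ?thesis using R unfolding recurs_def by (intro exI[of _ 0]) (simp split: if_splits)
  next
    case False
    then obtain i where "numeral b + r + i * r < e" "agree f a (numeral b + r + i * r) m"
      using R unfolding recurs_def by (auto split: if_splits)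
    then show ?thesis unfolding recurs_def by (intro exI[of _ "Suc i"]) (simp add: ac_simps)
  qed
qed

lemma all_interval_unfold:
  fixes a e :: nat
  shows "(\<forall>s. a \<le> s \<longrightarrow> s < e \<longrightarrow> P s) \<longleftrightarrow>
    (if a < e then if P a then \<forall>s. Suc a \<le> s \<longrightarrow> s < e \<longrightarrow> P s else False else True)"
proof -
  have "P s" if "P a" "\<forall>s. Suc a \<le> s \<longrightarrow> s < e \<longrightarrow> P s" "a \<le> s" "s < e" for s
    using that by (cases "s = a") auto
  then show ?thesis by auto
qed

lemma all_recur_unfold:
  "all_recur f m r k a e \<longleftrightarrow>
     (if a < e then
        if recurs f m r a (a + r) (a + k) then all_recur f m r k (Suc a) e else False
      else True)"
  unfolding all_recur_def by (rule all_interval_unfold)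

lemmas all_recur_numeral = all_recur_unfold[of _ _ _ _ "numeral a" for a]

lemma no_first_return_unfold:
  "no_first_return f m p a e \<longleftrightarrow>
     (if a < e then
        if if agree f a (a + p) m then recurs f m 1 a (a + 1) (a + p) else True
        then no_first_return f m p (Suc a) e else False
      else True)"
  unfolding no_first_return_def by (subst all_interval_unfold) simp

lemmas no_first_return_numeral = no_first_return_unfold[of _ _ _ "numeral a" for a]

lemma agree_numeral:
  "agree f a b (numeral m) \<longleftrightarrow>
    (if f a = f b then agree f (Suc a) (Suc b) (pred_numeral m) else False)"
  by (simp add: numeral_eq_Suc)

lemmas search_simps = all_recur_numeral no_first_return_numeral recurs_numeral agree_numeral

text \<open>Agreement inside a stretch of N letters sees only equalities of letters, so it survives
  any injective recoding \<open>g\<close>. For Rudin-Shapiro \<open>g\<close> is the identity or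
  complementation, for paperfolding the identity.\<close>

lemma matches_transfer:
  assumes "\<And>j. j < N \<Longrightarrow> v (A + j) = g (f (B + j))" "inj g" "s + d + m \<le> N"
  shows "matches v d (A + s) (A + s + m) \<longleftrightarrow> matches f d (B + s) (B + s + m)"
  unfolding agree_matches[symmetric] agree_iff
  using assms by (auto simp: add.assoc inj_eq)

lemma not_first_return_transfer:
  assumes c: "no_first_return f m p B e"
    and v: "\<And>j. j < N \<Longrightarrow> v (A + j) = g (f (B + j))" "inj g"
    and s: "s + p + m \<le> N" "B + s < e"
  shows "\<not> first_return v p (A + s) (A + s + m)"
proof
  assume r: "first_return v p (A + s) (A + s + m)"
  have "agree f (B + s) (B + s + p) m"
    using r matches_transfer[of N v A g f B s p m, OF v s(1)] unfolding first_return_def agree_matches by blast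
  then obtain i where i: "Suc i < p" "agree f (B + s) (B + s + Suc i) m"
    using c[unfolded no_first_return_def recurs_def, rule_format, of "B + s"] s(2) by auto
  then have "matches v (Suc i) (A + s) (A + s + m)"
    using matches_transfer[of N v A g f B s "Suc i" m, OF v] s(1) unfolding agree_matches by simp
  then show False using r i(1) unfolding first_return_def by blast
qed

lemma return_transfer:
  assumes c: "all_recur f m r k B e"
    and v: "\<And>j. j < N \<Longrightarrow> v (A + j) = g (f (B + j))" "inj g"
    and s: "s + k + m \<le> N" "B + s < e"
  shows "\<exists>i. i * r + r < k \<and> matches v (i * r + r) (A + s) (A + s + m)"
proof -
  obtain i where "B + s + r + i * r < B + s + k" "agree f (B + s) (B + s + r + i * r) m"
    using c[unfolded all_recur_def recurs_def, rule_format, of "B + s"] s(2) by auto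
  then have i: "i * r + r < k" "agree f (B + s) (B + s + (i * r + r)) m"
    by (simp_all add: ac_simps)
  then have "matches v (i * r + r) (A + s) (A + s + m)"
    using matches_transfer[of N v A g f B s "i * r + r" m, OF v] s(1) unfolding agree_matches
    by simp
  then show ?thesis using i(1) by blast
qed

section \<open>The Rudin-Shapiro sequence\<close>

definition rs :: "nat \<Rightarrow> bool" where
  "rs n \<longleftrightarrow> rudin_shapiro n = 1"

lemma rs_rec: "rs (2 * n) \<longleftrightarrow> rs n" "rs (2 * n + 1) \<longleftrightarrow> (rs n \<noteq> odd n)" "\<not> rs 0"
  and rudin_shapiro_eq: "rudin_shapiro = (\<lambda>n. of_bool (rs n))"
proof -
  let ?s = "fixed_point rudin_shapiro_morphism 0"
  have "length (rudin_shapiro_morphism c) = 2" for c by (simp add: rudin_shapiro_morphism_def)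
  note rec = uniform_fixed_point[OF fixed_point_sequences(4) this]
  have even: "?s (2 * n) \<in> {0, 3}" and odd: "?s (2 * n + 1) \<in> {1, 2}" for n
    unfolding rec by (auto simp: rudin_shapiro_morphism_def)
  have less: "?s n < 4" for n
    using even[of "n div 2"] odd[of "n div 2"] by (cases "even n") (auto elim!: evenE oddE)
  have rs: "rs n \<longleftrightarrow> 2 \<le> ?s n" and rs01: "rudin_shapiro n = of_bool (rs n)" for n
  proof -
    have "?s n = 0 \<or> ?s n = 1 \<or> ?s n = 2 \<or> ?s n = 3" using less[of n] by auto
    then show "rs n \<longleftrightarrow> 2 \<le> ?s n" "rudin_shapiro n = of_bool (rs n)"
      unfolding rs_def rudin_shapiro_def by auto
  qed
  show "rudin_shapiro = (\<lambda>n. of_bool (rs n))" using rs01 by blast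
  show "\<not> rs 0" by (simp add: rs fixed_point_sequences)
  have s: "?s n = 0 \<or> ?s n = 1 \<or> ?s n = 2 \<or> ?s n = 3" using less[of n] by auto
  then show "rs (2 * n) \<longleftrightarrow> rs n" unfolding rs rec by (auto simp: rudin_shapiro_morphism_def)
  have "?s n \<in> (if odd n then {1, 2} else {0, 3})"
    using even[of "n div 2"] odd[of "n div 2"] by (cases "even n") (auto elim!: evenE oddE)
  then show "rs (2 * n + 1) \<longleftrightarrow> (rs n \<noteq> odd n)"
    unfolding rs rec by (auto simp: rudin_shapiro_morphism_def split: if_splits)
qed

lemma rs_numeral [simp]:
  "rs (numeral (Num.Bit0 k)) \<longleftrightarrow> rs (numeral k)"
  "rs (numeral (Num.Bit1 k)) \<longleftrightarrow> (rs (numeral k) \<noteq> odd (numeral k :: nat))"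
  "\<not> rs 1" "\<not> rs (Suc 0)" "\<not> rs (Suc (Suc 0))" "rs (Suc (Suc (Suc 0)))" "\<not> rs 0"
proof -
  show "rs (numeral (Num.Bit0 k)) \<longleftrightarrow> rs (numeral k)"
    using rs_rec(1)[of "numeral k"] by simp
  show "rs (numeral (Num.Bit1 k)) \<longleftrightarrow> (rs (numeral k) \<noteq> odd (numeral k :: nat))"
    using rs_rec(2)[of "numeral k"] by simp
  show "\<not> rs 1" "\<not> rs (Suc 0)" "\<not> rs (Suc (Suc 0))" "rs (Suc (Suc (Suc 0)))" "\<not> rs 0"
    using rs_rec(2)[of 0] rs_rec(1)[of 1] rs_rec(2)[of 1] rs_rec(3) by (simp_all add: numeral_2_eq_2)
qed

section \<open>Rudin-Shapiro: distances at which a window can recur\<close>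

lemma rs_div: "rs x \<longleftrightarrow> (rs (x div 2) \<noteq> (odd x \<and> odd (x div 2)))"
  using rs_rec(1,2)[of "x div 2"] by (cases "even x") (auto elim!: evenE oddE)

text \<open>Appending a bit to x div 2 flips the letter iff the last two bits of x are 1. Evenness
  of d keeps these two bits unchanged under a shift by 2d.\<close>

lemma rs_matches_double:
  assumes "a < b" "even d"
  shows "matches rs (2 * d) a b \<longleftrightarrow> matches rs d (a div 2) ((b + 1) div 2)"
proof -
  have "rs x = rs (x + 2 * d) \<longleftrightarrow> rs (x div 2) = rs (x div 2 + d)" for x
  proof -
    have "(x + 2 * d) div 2 = x div 2 + d" "odd (x + 2 * d) \<longleftrightarrow> odd x"
      "odd (x div 2 + d) \<longleftrightarrow> odd (x div 2)" using assms(2) by auto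
    then show ?thesis using rs_div[of x] rs_div[of "x + 2 * d"] by metis
  qed
  then show ?thesis unfolding matches_def using ball_window_half[OF assms(1)] by simp
qed

lemma rs_change_even: "even x \<Longrightarrow> rs x \<noteq> rs (x + 1) \<longleftrightarrow> odd (x div 2)"
  using rs_rec(1,2)[of "x div 2"] by (auto elim!: evenE)

lemma rs_change_mod_4: "x mod 4 = 1 \<Longrightarrow> rs x \<noteq> rs (x + 1) \<longleftrightarrow> odd (x div 4)"
proof -
  assume x: "x mod 4 = 1"
  define y where "y = x div 4"
  have y: "x = 2 * (2 * y) + 1" "x + 1 = 2 * (2 * y + 1)" using x unfolding y_def by presburger+
  show ?thesis
    unfolding y_def[symmetric] y(2) unfolding y(1)
    using rs_rec(2)[of "2 * y"] rs_rec(1)[of "2 * y + 1"] rs_rec(1,2)[of y] by auto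
qed

text \<open>Three letters contain a pair x, x + 1 with x even, and the letter changes there iff x
  div 2 is odd. A shift congruent to 2 modulo 4 reverses that parity.\<close>

lemma rs_matches_even_4_dvd:
  assumes m: "matches rs d a b" and "a + 3 \<le> b" "even d"
  shows "4 dvd d"
proof (rule ccontr)
  assume "\<not> 4 dvd d"
  then have d: "odd (d div 2)" using assms(3) by (auto elim!: evenE)
  define x where "x = 2 * ((a + 1) div 2)"
  have x: "a \<le> x" "x + 1 < b" "even x" "even (x + d)" using assms unfolding x_def by auto
  have "(x + d) div 2 = x div 2 + d div 2" using x assms(3) by (auto elim!: evenE)
  then have "odd ((x + d) div 2) \<noteq> odd (x div 2)" using d by simp
  moreover have "rs x = rs (x + d)" "rs (x + 1) = rs (x + d + 1)"
    using m x unfolding matches_def by (auto simp: algebra_simps)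
  ultimately show False using rs_change_even[of x] rs_change_even[of "x + d"] x by metis
qed

text \<open>Under translation by 4, "the letter changes after y" is invariant for even y but
  alternates for y congruent to 1 modulo 4. An odd shift maps one kind onto the other for some x
  among the first three positions; comparing x with x + 4 reads up to x + 5, hence 8
  letters.\<close>

lemma rs_matches_4_dvd:
  assumes m: "matches rs d a b" and "a + 8 \<le> b"
  shows "4 dvd d"
proof (cases "even d")
  case True
  then show ?thesis using rs_matches_even_4_dvd[OF m] assms(2) by simp
next
  case odd: False
  have "\<exists>x. (x = a \<or> x = a + 1 \<or> x = a + 2) \<and>
      (x mod 4 = 1 \<or> even x \<and> (x + d) mod 4 = 1)"
    using odd by presburger
  then obtain x where "x = a \<or> x = a + 1 \<or> x = a + 2"
    and *: "x mod 4 = 1 \<or> even x \<and> (x + d) mod 4 = 1" by blast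
  then have x: "a \<le> x" "x + 5 < b" using assms(2) by auto
  have eq: "rs y = rs (y + d)" if "a \<le> y" "y < b" for y
    using m that unfolding matches_def by blast
  have change: "(rs x \<noteq> rs (x + 1)) = (rs (x + d) \<noteq> rs (x + d + 1))"
    "(rs (x + 4) \<noteq> rs (x + 4 + 1)) = (rs (x + d + 4) \<noteq> rs (x + d + 4 + 1))"
    using eq[of x] eq[of "x + 1"] eq[of "x + 4"] eq[of "x + 5"] x by (simp_all add: ac_simps)
  have c4: "(rs y \<noteq> rs (y + 1)) \<noteq> (rs (y + 4) \<noteq> rs (y + 4 + 1))" if "y mod 4 = 1" for y
    using rs_change_mod_4[of y] rs_change_mod_4[of "y + 4"] that div_add_self2[of 4 y] by simp
  have c2: "(rs y \<noteq> rs (y + 1)) = (rs (y + 4) \<noteq> rs (y + 4 + 1))" if "even y" for y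
    using rs_change_even[of y] rs_change_even[of "y + 4"] that by simp
  from * show ?thesis
  proof
    assume "x mod 4 = 1"
    moreover from this have "even (x + d)" using odd by presburger
    ultimately show ?thesis using c4[of x] c2[of "x + d"] change by blast
  next
    assume "even x \<and> (x + d) mod 4 = 1"
    then show ?thesis using c2[of x] c4[of "x + d"] change by blast
  qed
qed

lemma rs_matches_power_dvd:
  assumes "matches rs d a b" "a + 2 ^ Suc j + 1 \<le> b" "even d"
  shows "2 ^ Suc (Suc j) dvd d"
  using assms
proof (induction j arbitrary: d a b)
  case 0
  then show ?case using rs_matches_even_4_dvd[of d a b] by simp
next
  case (Suc j)
  have "4 dvd d" proof (rule rs_matches_even_4_dvd[OF Suc.prems(1)])
    have "0 < (2 :: nat) ^ j" by simp
    then show "a + 3 \<le> b" using Suc.prems(2) unfolding power_Suc by linarith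
  qed (use Suc.prems in simp)
  then obtain e where e: "d = 2 * e" "even e" by (auto elim!: dvdE)
  have ab: "a < b" using Suc.prems by simp
  have "matches rs e (a div 2) ((b + 1) div 2)"
    using Suc.prems(1) rs_matches_double[OF ab e(2)] e(1) by simp
  moreover have "a div 2 + 2 ^ Suc j + 1 \<le> (b + 1) div 2" using Suc.prems(2) by auto
  ultimately have "2 ^ Suc (Suc j) dvd e" using Suc.IH e(2) by blast
  then show ?case using e(1) by simp
qed

text \<open>The sequence gives the parity of the number of factors 11 in the binary expansion.
  Writing the bits of j after those of c creates one extra 11 exactly when c is odd and the top bit
  of j is set.\<close>

lemma rs_block:
  assumes "j < 2 * 2 ^ t"
  shows "rs (2 * 2 ^ t * c + j) \<longleftrightarrow> ((rs c \<noteq> (odd c \<and> 2 ^ t \<le> j)) \<noteq> rs j)"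
  using assms
proof (induction t arbitrary: j)
  case 0
  then consider "j = 0" | "j = 1" by force
  then show ?case using rs_rec(1,2)[of c] by cases auto
next
  case (Suc t)
  let ?x = "2 * 2 ^ Suc t * c + j"
  have x: "?x div 2 = 2 * 2 ^ t * c + j div 2" "odd ?x \<longleftrightarrow> odd j" by auto
  then have "odd (?x div 2) \<longleftrightarrow> odd (j div 2)" by simp
  moreover have "2 ^ t \<le> j div 2 \<longleftrightarrow> 2 ^ Suc t \<le> j" by auto
  moreover have "j div 2 < 2 * 2 ^ t" using Suc.prems by auto
  ultimately show ?case
    using Suc.IH[of "j div 2"] rs_div[of ?x] rs_div[of j] x by metis
qed

text \<open>Letters \<open>2q \<le> x < 6q\<close> of \<open>rs_pair q p w\<close>, with \<open>q\<close> a power of 2, are two consecutive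
  blocks of length \<open>2q\<close> of the sequence, up to complementation. Here \<open>p\<close> is the parity of the
  index of the first block, and \<open>w\<close> tells whether the blocks start with different letters.\<close>

definition rs_pair :: "nat \<Rightarrow> bool \<Rightarrow> bool \<Rightarrow> nat \<Rightarrow> bool" where
  "rs_pair q p w x \<longleftrightarrow>
     rs x \<noteq> (if x < 3 * q then False else if x < 4 * q then \<not> p else if x < 5 * q then w else w = p)"

text \<open>The blocks of index 1 and 2 serve as reference, and \<open>rs_pair\<close> corrects them
  to those of index c and c + 1. Their offset 2q makes every searched position a numeral, as the
  search equations require.\<close>

lemma rs_pair:
  assumes q: "q = 2 ^ t" and j: "j < 4 * q"
  shows "rs (2 * q * c + j) \<longleftrightarrow> rs c \<noteq> rs_pair q (odd c) (rs c \<noteq> rs (Suc c)) (2 * q + j)"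
proof (cases "j < 2 * q")
  case True
  then show ?thesis
    using rs_block[of j t c] rs_block[of j t 1] q by (auto simp: rs_pair_def)
next
  case False
  define i where "i = j - 2 * q"
  have i: "j = 2 * q + i" "i < 2 * q" using False j by (auto simp: i_def)
  have e: "2 * q * c + j = 2 * q * Suc c + i" "2 * q + j = 2 * q * 2 + i" using i by simp_all
  have 1: "rs (2 * q + j) \<longleftrightarrow> rs i"
    unfolding e(2) using rs_block[of i t 2] i(2) q by simp
  have 2: "rs (2 * q * c + j) \<longleftrightarrow> ((rs (Suc c) \<noteq> (even c \<and> q \<le> i)) \<noteq> rs i)"
    unfolding e(1) using rs_block[of i t "Suc c"] i(2) q by simp
  have "2 * q + j < 5 * q \<longleftrightarrow> \<not> q \<le> i" using i by auto
  then show ?thesis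
    unfolding rs_pair_def 1 2 using False by (cases "q \<le> i"; simp; blast)
qed

text \<open>A window starting in block c, together with its shift by d, stays within blocks c and c
  + 1 because d + m <= 2q; so checking starts in the first block of the four models covers every
  position.\<close>

lemma rs_not_first_return:
  assumes c: "\<And>p w. no_first_return (rs_pair q p w) m d (2 * q) (4 * q)"
    and q: "q = 2 ^ t" "d + m \<le> 2 * q"
  shows "\<not> first_return rs d a (a + m)"
proof -
  define c where "c = a div (2 * q)"
  define s where "s = a mod (2 * q)"
  have s: "a = 2 * q * c + s" "s < 2 * q" using q by (simp_all add: c_def s_def)
  have "inj ((\<noteq>) (rs c))" by (auto simp: inj_def)
  then show ?thesis unfolding s(1)
    by (rule not_first_return_transfer[OF assms(1)[of "odd c" "rs c \<noteq> rs (Suc c)"], rotated])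
      (use s q rs_pair[OF q(1)] in auto)
qed

lemma rs_return_transfer:
  assumes c: "\<And>p w. all_recur (rs_pair q p w) m r k (2 * q) (4 * q)"
    and q: "q = 2 ^ t" "k + m \<le> 2 * q"
  shows "\<exists>i. i * r + r < k \<and> matches rs (i * r + r) a (a + m)"
proof -
  define c where "c = a div (2 * q)"
  define s where "s = a mod (2 * q)"
  have s: "a = 2 * q * c + s" "s < 2 * q" using q by (simp_all add: c_def s_def)
  have "inj ((\<noteq>) (rs c))" by (auto simp: inj_def)
  then show ?thesis unfolding s(1)
    by (rule return_transfer[OF assms(1)[of "odd c" "rs c \<noteq> rs (Suc c)"], rotated])
      (use s q rs_pair[OF q(1)] in auto)
qed

lemma rs_pair_numeral:
  "rs_pair 16 p w (numeral x) \<longleftrightarrow> rs (numeral x) \<noteq>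
    (if numeral x < (48 :: nat) then False else if numeral x < (64 :: nat) then \<not> p
     else if numeral x < (80 :: nat) then w else w = p)"
  "rs_pair 32 p w (numeral x) \<longleftrightarrow> rs (numeral x) \<noteq>
    (if numeral x < (96 :: nat) then False else if numeral x < (128 :: nat) then \<not> p
     else if numeral x < (160 :: nat) then w else w = p)"
  "rs_pair 64 p w (numeral x) \<longleftrightarrow> rs (numeral x) \<noteq>
    (if numeral x < (192 :: nat) then False else if numeral x < (256 :: nat) then \<not> p
     else if numeral x < (320 :: nat) then w else w = p)"
  "rs_pair 128 p w (numeral x) \<longleftrightarrow> rs (numeral x) \<noteq>
    (if numeral x < (384 :: nat) then False else if numeral x < (512 :: nat) then \<not> p
     else if numeral x < (640 :: nat) then w else w = p)"
  by (simp_all add: rs_pair_def)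

section \<open>Rudin-Shapiro: early returns of short windows\<close>

lemma rs_return_2: "\<exists>d. 0 < d \<and> d \<le> 20 \<and> even d \<and> matches rs d a (a + 2)"
proof -
  have "all_recur (rs_pair 16 p w) 2 2 21 (2 * 16) (4 * 16)" for p w
    by (cases p; cases w; simp add: search_simps rs_pair_numeral)
  from rs_return_transfer[OF this, of 4 a]
  obtain i where "i * 2 + 2 < 21" "matches rs (i * 2 + 2) a (a + 2)" by auto
  then show ?thesis by (intro exI[of _ "i * 2 + 2"]) auto
qed

text \<open>A window of 2^(j+1) + 1 letters halves into one of 2^j + 1 letters whatever the parity
  of its start. The distance must stay even so that the return can be doubled again.\<close>

lemma rs_return: "\<exists>d. 0 < d \<and> d \<le> 20 * 2 ^ j \<and> even d \<and> matches rs d a (a + 2 ^ j + 1)"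
proof (induction j arbitrary: a)
  case 0
  then show ?case using rs_return_2[of a] by (simp add: numeral_2_eq_2)
next
  case (Suc j)
  obtain d where d: "0 < d" "d \<le> 20 * 2 ^ j" "even d"
      "matches rs d (a div 2) (a div 2 + 2 ^ j + 1)" using Suc by blast
  have "(a + 2 ^ Suc j + 1 + 1) div 2 = a div 2 + 2 ^ j + 1" by auto
  moreover have "a < a + 2 ^ Suc j + 1" by simp
  ultimately have "matches rs (2 * d) a (a + 2 ^ Suc j + 1)"
    using d(4) by (simp only: rs_matches_double[OF _ d(3)])
  then show ?case using d by (intro exI[of _ "2 * d"]) simp
qed

lemma rs_first_return_le:
  assumes "first_return rs p a b" "b \<le> a + 2 ^ j + 1"
  shows "p \<le> 20 * 2 ^ j"
proof -
  obtain d where d: "0 < d" "d \<le> 20 * 2 ^ j" "matches rs d a (a + 2 ^ j + 1)"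
    using rs_return by blast
  then have "matches rs d a b" using assms(2) by (auto elim: matches_mono)
  then show ?thesis using assms(1) d unfolding first_return_def by (meson not_le_imp_less order.trans)
qed

text \<open>These are the pairs that neither the bound of \<open>rs_first_return_le\<close> nor
  divisibility by powers of two excludes; except for the first, the distance is odd and the window
  too short for \<open>rs_matches_4_dvd\<close>.\<close>

lemma rs_no_first_return:
  "\<not> first_return rs 32 a (a + 3)" "\<not> first_return rs 31 a (a + 4)"
  "\<not> first_return rs 29 a (a + 6)" "\<not> first_return rs 63 a (a + 4)"
  "\<not> first_return rs 61 a (a + 6)" "\<not> first_return rs 123 a (a + 6)"
  "\<not> first_return rs 125 a (a + 6)" "\<not> first_return rs 127 a (a + 6)"
  "\<not> first_return rs 123 a (a + 7)" "\<not> first_return rs 125 a (a + 7)"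
proof -
  have "no_first_return (rs_pair 32 p w) 3 32 (2 * 32) (4 * 32)" for p w
    by (cases p; cases w; simp add: search_simps rs_pair_numeral)
  from rs_not_first_return[OF this, of 5] show "\<not> first_return rs 32 a (a + 3)" by simp
  have "no_first_return (rs_pair 32 p w) 4 31 (2 * 32) (4 * 32)" for p w
    by (cases p; cases w; simp add: search_simps rs_pair_numeral)
  from rs_not_first_return[OF this, of 5] show "\<not> first_return rs 31 a (a + 4)" by simp
  have "no_first_return (rs_pair 32 p w) 6 29 (2 * 32) (4 * 32)" for p w
    by (cases p; cases w; simp add: search_simps rs_pair_numeral)
  from rs_not_first_return[OF this, of 5] show "\<not> first_return rs 29 a (a + 6)" by simp
  have "no_first_return (rs_pair 64 p w) 4 63 (2 * 64) (4 * 64)" for p w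
    by (cases p; cases w; simp add: search_simps rs_pair_numeral)
  from rs_not_first_return[OF this, of 6] show "\<not> first_return rs 63 a (a + 4)" by simp
  have "no_first_return (rs_pair 64 p w) 6 61 (2 * 64) (4 * 64)" for p w
    by (cases p; cases w; simp add: search_simps rs_pair_numeral)
  from rs_not_first_return[OF this, of 6] show "\<not> first_return rs 61 a (a + 6)" by simp
  have "no_first_return (rs_pair 128 p w) 6 123 (2 * 128) (4 * 128)" for p w
    by (cases p; cases w; simp add: search_simps rs_pair_numeral)
  from rs_not_first_return[OF this, of 7] show "\<not> first_return rs 123 a (a + 6)" by simp
  have "no_first_return (rs_pair 128 p w) 6 125 (2 * 128) (4 * 128)" for p w
    by (cases p; cases w; simp add: search_simps rs_pair_numeral)
  from rs_not_first_return[OF this, of 7] show "\<not> first_return rs 125 a (a + 6)" by simp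
  have "no_first_return (rs_pair 128 p w) 6 127 (2 * 128) (4 * 128)" for p w
    by (cases p; cases w; simp add: search_simps rs_pair_numeral)
  from rs_not_first_return[OF this, of 7] show "\<not> first_return rs 127 a (a + 6)" by simp
  have "no_first_return (rs_pair 128 p w) 7 123 (2 * 128) (4 * 128)" for p w
    by (cases p; cases w; simp add: search_simps rs_pair_numeral)
  from rs_not_first_return[OF this, of 7] show "\<not> first_return rs 123 a (a + 7)" by simp
  have "no_first_return (rs_pair 128 p w) 7 125 (2 * 128) (4 * 128)" for p w
    by (cases p; cases w; simp add: search_simps rs_pair_numeral)
  from rs_not_first_return[OF this, of 7] show "\<not> first_return rs 125 a (a + 7)" by simp
qed

section \<open>Rudin-Shapiro: lengths without closed factors\<close>

lemma rs_first_return_power_dvd: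
  assumes r: "first_return rs p a (a + m)" and m: "2 ^ Suc j < m" and p: "even p \<or> 8 \<le> m"
  shows "2 ^ Suc (Suc j) dvd p"
proof -
  have r': "matches rs p a (a + m)" using r by (simp add: first_return_def)
  have "4 dvd p" if "8 \<le> m" using rs_matches_4_dvd[OF r'] that by simp
  then have "even p" using p by presburger
  then show ?thesis using rs_matches_power_dvd[OF r'] m by simp
qed

text \<open>With K = 2^(k-5): for m <= K + 1 the return bound gives p + m <= 21 K + 1, too short.
  For m >= K + 2, p < 32 K, and with 2^j < m <= 2^(j+1) the distance p is a multiple of 2^(j+1).
  Equality m = 2^(j+1) is possible, so 2^k itself is not excluded.\<close>

lemma rs_excluded:
  assumes r: "first_return rs p a (a + m)" and k: "7 \<le> k"
    and n: "2 ^ k < p + m" "p + m \<le> 2 ^ k + 2 ^ (k - 5) + 1"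
  shows False
proof -
  define i where "i = k - 5"
  define K where "K = (2 :: nat) ^ i"
  have i: "2 \<le> i" "k = i + 5" using k by (auto simp: i_def)
  have K: "32 * K < p + m" "p + m \<le> 33 * K + 1" "4 \<le> K"
  proof -
    have "2 ^ 2 \<le> (2 :: nat) ^ i" using i(1) by (intro power_increasing) auto
    then show "4 \<le> K" by (simp add: K_def)
    show "32 * K < p + m" "p + m \<le> 33 * K + 1" using n by (simp_all add: K_def i(2) power_add)
  qed
  have "0 < p" "0 < m" using r by (simp_all add: first_return_def)
  show False
  proof (cases "m \<le> K + 1")
    case True
    then have "p \<le> 20 * K" using rs_first_return_le[OF r, of i] by (simp add: K_def)
    then show False using True K by linarith
  next
    case False
    then have "0 < m - 1" using K by linarith
    then obtain j where j: "2 ^ j \<le> m - 1" "m - 1 < 2 * 2 ^ j" by (rule power_of_2_between)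
    have ij: "i \<le> j"
    proof (rule ccontr)
      assume "\<not> i \<le> j"
      then have "(2 :: nat) ^ Suc j \<le> 2 ^ i" by (intro power_increasing) auto
      then show False using j(2) False by (simp add: K_def)
    qed
    then obtain j' where j': "j = Suc j'" using i(1) by (cases j) auto
    have "even p \<or> 8 \<le> m"
    proof (rule ccontr)
      assume *: "\<not> (even p \<or> 8 \<le> m)"
      then have "K < 7" using False by simp
      have "i = 2"
      proof (rule ccontr)
        assume "i \<noteq> 2"
        then have "2 ^ 3 \<le> (2 :: nat) ^ i" using i(1) by (intro power_increasing) auto
        then show False using \<open>K < 7\<close> by (simp add: K_def)
      qed
      then have "K = 4" by (simp add: K_def)
      \<comment> \<open>Only k = 7 leaves room for odd p: windows of 6 or 7 letters and total length
        129 to 133.\<close>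
      then have "m = 6 \<and> (p = 123 \<or> p = 125 \<or> p = 127) \<or> m = 7 \<and> (p = 123 \<or> p = 125)"
        using * False K by presburger
      then show False using r rs_no_first_return by auto
    qed
    then have d: "2 ^ Suc j dvd p"
      using rs_first_return_power_dvd[OF r, of j'] j(1) \<open>0 < m - 1\<close> unfolding j' by linarith
    have p: "p < 32 * K" using False K by linarith
    have mj: "m \<le> 2 ^ Suc j" using j(2) by simp
    show False
    proof (cases "j < i + 5")
      case True
      then have "2 ^ Suc j dvd (2 :: nat) ^ (i + 5)" by (intro le_imp_power_dvd) simp
      then have "2 ^ Suc j dvd 32 * K - p" using d by (auto intro!: dvd_diff_nat simp: K_def power_add)
      \<comment> \<open>A positive multiple of 2^(j+1) is at least m, so p + m <= 32 K, contrary to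
        the lower bound.\<close>
      then have "2 ^ Suc j \<le> 32 * K - p" using p by (intro dvd_imp_le) auto
      then show False using mj K p by linarith
    next
      case False
      then have "(2 :: nat) ^ (i + 5) \<le> 2 ^ Suc j" by (intro power_increasing) auto
      moreover have "2 ^ Suc j \<le> p" using d \<open>0 < p\<close> by (intro dvd_imp_le) auto
      ultimately show False using p by (simp add: K_def power_add)
    qed
  qed
qed

text \<open>Each m determines p. The return bound or divisibility by powers of two rules out all but
  five pairs, which \<open>rs_no_first_return\<close> refutes.\<close>

lemma rs_excluded_35_67:
  assumes r: "first_return rs p a (a + m)"
  shows "p + m \<noteq> 35" "p + m \<noteq> 67"
proof -
  have pos: "0 < p" "0 < m" using r by (simp_all add: first_return_def)
  have "p \<le> 20" if "m \<le> 2" using rs_first_return_le[OF r, of 0] that by simp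
  moreover have "p \<le> 40" if "m \<le> 3" using rs_first_return_le[OF r, of 1] that by simp
  moreover have "8 dvd p" if "5 \<le> m" "even p \<or> 8 \<le> m"
    using rs_first_return_power_dvd[OF r, of 1] that by simp
  moreover have "16 dvd p" if "9 \<le> m" using rs_first_return_power_dvd[OF r, of 2] that by simp
  moreover have "32 dvd p" if "17 \<le> m" using rs_first_return_power_dvd[OF r, of 3] that by simp
  moreover have "64 dvd p" if "33 \<le> m" using rs_first_return_power_dvd[OF r, of 4] that by simp
  moreover have "4 dvd p" if "3 \<le> m" "even p"
    using rs_matches_even_4_dvd[of p a "a + m"] r that by (simp add: first_return_def)
  moreover have "\<not> (m = 3 \<and> p = 32)" "\<not> (m = 4 \<and> p = 31)" "\<not> (m = 6 \<and> p = 29)"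
    "\<not> (m = 4 \<and> p = 63)" "\<not> (m = 6 \<and> p = 61)" using r rs_no_first_return by auto
  note facts = calculation this
  show "p + m \<noteq> 35"
  proof
    assume n: "p + m = 35"
    consider "m \<le> 2" | "m = 3" | "m = 4" | "m = 5" | "m = 6" | "m = 7" | "m = 8"
      | "9 \<le> m" "m \<le> 16" | "17 \<le> m" by linarith
    then show False using facts n pos by cases (simp_all, presburger+)
  qed
  show "p + m \<noteq> 67"
  proof
    assume n: "p + m = 67"
    consider "m \<le> 3" | "m = 4" | "m = 5" | "m = 6" | "m = 7" | "m = 8"
      | "9 \<le> m" "m \<le> 16" | "17 \<le> m" "m \<le> 32" | "33 \<le> m" by linarith
    then show False using facts n pos by cases (simp_all, presburger+)
  qed
qed

text \<open>With K = 4 2^j the initial window has K + 2 letters and first return 32 K. So the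
  interval of \<open>rs_excluded\<close> is sharp at its upper end: the next length, 33 K + 2, is
  closed.\<close>

lemma rs_family1:
  shows "first_return rs (128 * 2 ^ j) (48 * 2 ^ j - 1) (52 * 2 ^ j + 1)"
    and "matches rs (128 * 2 ^ j) 0 (64 * 2 ^ j)"
proof (induction j)
  case 0
  show "first_return rs (128 * 2 ^ 0) (48 * 2 ^ 0 - 1) (52 * 2 ^ 0 + 1)"
    and "matches rs (128 * 2 ^ 0) 0 (64 * 2 ^ 0)"
    by (simp_all add: first_return_code matches_code upt_eval)
next
  case (Suc j)
  have half: "(48 * 2 ^ Suc j - 1 :: nat) div 2 = 48 * 2 ^ j - 1"
    "(52 * 2 ^ Suc j + 1 + 1 :: nat) div 2 = 52 * 2 ^ j + 1" by auto
  have lt: "(48 * 2 ^ j - 1 :: nat) < 52 * 2 ^ j + 1" for j by (simp add: less_Suc_eq_le)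
  show "matches rs (128 * 2 ^ Suc j) 0 (64 * 2 ^ Suc j)"
    using Suc(2) rs_matches_double[of 0 "64 * 2 ^ Suc j" "128 * 2 ^ j"] by simp
  have eq: "matches rs (2 * d) (48 * 2 ^ Suc j - 1) (52 * 2 ^ Suc j + 1) \<longleftrightarrow>
      matches rs d (48 * 2 ^ j - 1) (52 * 2 ^ j + 1)" if "even d" for d
    unfolding rs_matches_double[OF lt that] half ..
  have j: "2 \<le> (2 :: nat) ^ Suc j" by simp
  show "first_return rs (128 * 2 ^ Suc j) (48 * 2 ^ Suc j - 1) (52 * 2 ^ Suc j + 1)"
    unfolding first_return_def
  proof (intro conjI allI impI)
    show "matches rs (128 * 2 ^ Suc j) (48 * 2 ^ Suc j - 1) (52 * 2 ^ Suc j + 1)"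
      using Suc(1) eq[of "128 * 2 ^ j"] by (simp add: first_return_def)
    fix d :: nat assume d: "0 < d" "d < 128 * 2 ^ Suc j"
    show "\<not> matches rs d (48 * 2 ^ Suc j - 1) (52 * 2 ^ Suc j + 1)"
    proof
      assume m: "matches rs d (48 * 2 ^ Suc j - 1) (52 * 2 ^ Suc j + 1)"
      then have "4 dvd d" by (rule rs_matches_4_dvd) (use j in linarith)
      then obtain e where "d = 2 * e" "even e" by (auto elim!: dvdE)
      then show False using m eq[of e] Suc(1) d by (simp add: first_return_def)
    qed
  qed (use lt in auto)
qed

lemma rs_family2:
  shows "first_return rs (8 * 2 ^ j) (30 * 2 ^ j - 1) (33 * 2 ^ j + 1)"
    and "matches rs (8 * 2 ^ j) (28 * 2 ^ j) (36 * 2 ^ j)"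
proof (induction j)
  case 0
  show "first_return rs (8 * 2 ^ 0) (30 * 2 ^ 0 - 1) (33 * 2 ^ 0 + 1)"
    and "matches rs (8 * 2 ^ 0) (28 * 2 ^ 0) (36 * 2 ^ 0)"
    by (simp_all add: first_return_code matches_code upt_eval)
next
  case (Suc j)
  have half: "(30 * 2 ^ Suc j - 1 :: nat) div 2 = 30 * 2 ^ j - 1"
    "(33 * 2 ^ Suc j + 1 + 1 :: nat) div 2 = 33 * 2 ^ j + 1" by auto
  have lt: "(30 * 2 ^ j - 1 :: nat) < 33 * 2 ^ j + 1" for j by (simp add: less_Suc_eq_le)
  show "matches rs (8 * 2 ^ Suc j) (28 * 2 ^ Suc j) (36 * 2 ^ Suc j)"
    using Suc(2) rs_matches_double[of "28 * 2 ^ Suc j" "36 * 2 ^ Suc j" "8 * 2 ^ j"] by simp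
  have eq: "matches rs (2 * d) (30 * 2 ^ Suc j - 1) (33 * 2 ^ Suc j + 1) \<longleftrightarrow>
      matches rs d (30 * 2 ^ j - 1) (33 * 2 ^ j + 1)" if "even d" for d
    unfolding rs_matches_double[OF lt that] half ..
  have j: "1 \<le> (2 :: nat) ^ j" by simp
  show "first_return rs (8 * 2 ^ Suc j) (30 * 2 ^ Suc j - 1) (33 * 2 ^ Suc j + 1)"
    unfolding first_return_def
  proof (intro conjI allI impI)
    show "matches rs (8 * 2 ^ Suc j) (30 * 2 ^ Suc j - 1) (33 * 2 ^ Suc j + 1)"
      using Suc(1) eq[of "8 * 2 ^ j"] by (simp add: first_return_def)
    fix d :: nat assume d: "0 < d" "d < 8 * 2 ^ Suc j"
    show "\<not> matches rs d (30 * 2 ^ Suc j - 1) (33 * 2 ^ Suc j + 1)"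
    proof
      assume m: "matches rs d (30 * 2 ^ Suc j - 1) (33 * 2 ^ Suc j + 1)"
      then have "4 dvd d" by (rule rs_matches_4_dvd) (use j in simp)
      then obtain e where "d = 2 * e" "even e" by (auto elim!: dvdE)
      then show False using m eq[of e] Suc(1) d by (simp add: first_return_def)
    qed
  qed (use lt in auto)
qed

lemma rs_closed1:
  assumes "132 * 2 ^ j + 2 \<le> n" "n \<le> 192 * 2 ^ j"
  shows "has_closed_factor rs n"
proof -
  have "(52 * 2 ^ j + 1) - (48 * 2 ^ j - 1) = 4 * 2 ^ j + (2 :: nat)" using one_le_power[of "2 :: nat" j]
    by linarith
  then show ?thesis
    using has_closed_factor_range[OF rs_family1(1) rs_family1(2)[of j], of n] assms by simp
qed

lemma rs_closed2:
  assumes "11 * 2 ^ j + 2 \<le> n" "n \<le> 16 * 2 ^ j"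
  shows "has_closed_factor rs n"
proof -
  have "(33 * 2 ^ j + 1) - (30 * 2 ^ j - 1) = 3 * 2 ^ j + (2 :: nat)"
    "28 * 2 ^ j \<le> 30 * 2 ^ j - (1 :: nat)" using one_le_power[of "2 :: nat" j]
    by linarith+
  then show ?thesis
    using has_closed_factor_range[OF rs_family2(1) rs_family2(2)[of j], of n] assms by simp
qed

text \<open>Each instance settles an interval of lengths, and the intervals leave only 35 and 67
  open; the argument by contradiction pushes n past them one by one.\<close>

lemma rs_small:
  assumes "n \<le> 96" "n \<noteq> 35" "n \<noteq> 67"
  shows "has_closed_factor rs n"
proof -
  have r2: "has_closed_factor rs n" if "1 < n" "n \<le> 4"
    by (rule has_closed_factor_range[of rs 1 7 8 7 10])
      (use that in \<open>simp_all add: first_return_code matches_code upt_eval\<close>)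
  have r5: "has_closed_factor rs n" if "4 < n" "n \<le> 8"
    by (rule has_closed_factor_range[of rs 3 1 3 1 6])
      (use that in \<open>simp_all add: first_return_code matches_code upt_eval\<close>)
  have r9: "has_closed_factor rs n" if "8 < n" "n \<le> 11"
    by (rule has_closed_factor_range[of rs 5 27 31 27 33])
      (use that in \<open>simp_all add: first_return_code matches_code upt_eval\<close>)
  have r12: "has_closed_factor rs n" if "11 < n" "n \<le> 12"
    by (rule has_closed_factor_range[of rs 7 62 67 62 67])
      (use that in \<open>simp_all add: first_return_code matches_code upt_eval\<close>)
  have r13: "has_closed_factor rs n" if "12 < n" "n \<le> 16"
    by (rule has_closed_factor_range[of rs 8 29 34 28 36])
      (use that in \<open>simp_all add: first_return_code matches_code upt_eval\<close>)
  have r16: "has_closed_factor rs n" if "15 < n" "n \<le> 18"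
    by (rule has_closed_factor_range[of rs 11 15 20 15 22])
      (use that in \<open>simp_all add: first_return_code matches_code upt_eval\<close>)
  have r19: "has_closed_factor rs n" if "18 < n" "n \<le> 19"
    by (rule has_closed_factor_range[of rs 16 40 43 40 43])
      (use that in \<open>simp_all add: first_return_code matches_code upt_eval\<close>)
  have r20: "has_closed_factor rs n" if "19 < n" "n \<le> 24"
    by (rule has_closed_factor_range[of rs 16 3 7 0 8])
      (use that in \<open>simp_all add: first_return_code matches_code upt_eval\<close>)
  have r33: "has_closed_factor rs n" if "32 < n" "n \<le> 34"
    by (rule has_closed_factor_range[of rs 27 80 86 79 86])
      (use that in \<open>simp_all add: first_return_code matches_code upt_eval\<close>)
  have r36: "has_closed_factor rs n" if "35 < n" "n \<le> 48"
    by (rule has_closed_factor_range[of rs 32 9 13 0 16])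
      (use that in \<open>simp_all add: first_return_code matches_code upt_eval\<close>)
  have r65: "has_closed_factor rs n" if "64 < n" "n \<le> 65"
    by (rule has_closed_factor_range[of rs 59 240 246 240 246])
      (use that in \<open>simp_all add: first_return_code matches_code upt_eval\<close>)
  have r66: "has_closed_factor rs n" if "65 < n" "n \<le> 66"
    by (rule has_closed_factor_range[of rs 61 164 169 164 169])
      (use that in \<open>simp_all add: first_return_code matches_code upt_eval\<close>)
  have r68: "has_closed_factor rs n" if "67 < n" "n \<le> 96"
    by (rule has_closed_factor_range[of rs 64 21 25 0 32])
      (use that in \<open>simp_all add: first_return_code matches_code upt_eval\<close>)
  have r24: "has_closed_factor rs n" if "23 < n" "n \<le> 32" using rs_closed2[of 1 n] that by simp
  have r46: "has_closed_factor rs n" if "45 < n" "n \<le> 64" using rs_closed2[of 2 n] that by simp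
  have r0: "has_closed_factor rs n" if "n \<le> 1" using that by (simp add: has_closed_factor_iff)
  show ?thesis
  proof (rule ccontr)
    assume c: "\<not> has_closed_factor rs n"
    then have "1 < n" using r0 by (metis not_le)
    then have "4 < n" using r2 c by (metis not_le)
    then have "8 < n" using r5 c by (metis not_le)
    then have "11 < n" using r9 c by (metis not_le)
    then have "12 < n" using r12 c by (metis not_le)
    then have "16 < n" using r13 c by (metis not_le)
    then have "15 < n" using assms by linarith
    then have "18 < n" using r16 c by (metis not_le)
    then have "19 < n" using r19 c by (metis not_le)
    then have "24 < n" using r20 c by (metis not_le)
    then have "23 < n" using assms by linarith
    then have "32 < n" using r24 c by (metis not_le)
    then have "34 < n" using r33 c by (metis not_le)
    then have "35 < n" using assms by linarith
    then have "48 < n" using r36 c by (metis not_le)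
    then have "45 < n" using assms by linarith
    then have "64 < n" using r46 c by (metis not_le)
    then have "65 < n" using r65 c by (metis not_le)
    then have "66 < n" using r66 c by (metis not_le)
    then have "67 < n" using assms by linarith
    then have "96 < n" using r68 c by (metis not_le)
    then show False using assms by linarith
  qed
qed

lemma rudin_shapiro_closed_iff:
  "has_closed_factor rudin_shapiro n \<longleftrightarrow>
    n \<noteq> 35 \<and> n \<noteq> 67 \<and> \<not> (\<exists>k\<ge>7. 2 ^ k < n \<and> n \<le> 2 ^ k + 2 ^ (k - 5) + 1)"
  (is "_ \<longleftrightarrow> ?P")
proof -
  have "has_closed_factor rs n \<longleftrightarrow> ?P"
  proof
    assume c: "has_closed_factor rs n"
    show ?P
    proof (cases "n \<le> 1")
      case True
      have "\<not> 2 ^ k < n" for k using True one_le_power[of "2 :: nat" k] by linarith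
      then show ?thesis using True by auto
    next
      case False
      then obtain a b p where r: "first_return rs p a b" "n = p + (b - a)"
        using c unfolding has_closed_factor_iff by auto
      then have "b = a + (b - a)" by (simp add: first_return_def)
      then have "first_return rs p a (a + (b - a))" using r(1) by simp
      from rs_excluded[OF this] rs_excluded_35_67[OF this] show ?thesis
        unfolding r(2) by blast
    qed
  next
    assume P: ?P
    show "has_closed_factor rs n"
    proof (cases "n \<le> 96")
      case True
      then show ?thesis using rs_small P by blast
    next
      case False
      then have "0 < (n - 1) div 64" by simp
      then obtain j where "2 ^ j \<le> (n - 1) div 64" "(n - 1) div 64 < 2 * 2 ^ j"
        by (rule power_of_2_between)
      then have n: "64 * 2 ^ j < n" "n \<le> 128 * 2 ^ j" using False by linarith+
      show ?thesis
      proof (cases "n \<le> 96 * 2 ^ j")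
        case True
        then obtain i where i: "j = Suc i" using False by (cases j) auto
        have "\<not> (2 ^ (i + 7) < n \<and> n \<le> 2 ^ (i + 7) + 2 ^ (i + 7 - 5) + 1)"
          using P by (meson le_add2)
        moreover have "(2 :: nat) ^ (i + 7) = 128 * 2 ^ i" "(2 :: nat) ^ (i + 7 - 5) = 4 * 2 ^ i"
          by (simp_all add: power_add)
        ultimately show ?thesis using rs_closed1[of i n] n True i by simp
      next
        case False
        \<comment> \<open>Three doublings turn the second family into the lengths from 88 2^j + 2 to
          128 2^j, overlapping the first family's range.\<close>
        then show ?thesis using rs_closed2[of "j + 3" n] n by (simp add: power_add)
      qed
    qed
  qed
  then show ?thesis by (simp add: rudin_shapiro_eq has_closed_factor_of_bool)
qed

section \<open>The paperfolding sequence\<close>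

definition pf :: "nat \<Rightarrow> bool" where
  "pf n \<longleftrightarrow> paperfolding n = 1"

lemma pf_rec: "pf (2 * n) \<longleftrightarrow> odd n" "pf (2 * n + 1) \<longleftrightarrow> pf n"
proof -
  show "pf (2 * n) \<longleftrightarrow> odd n"
    using paperfolding_rec(2,3)[of "n div 2"] unfolding pf_def
    by (cases "even n") (auto elim!: evenE oddE simp: algebra_simps)
  show "pf (2 * n + 1) \<longleftrightarrow> pf n" unfolding pf_def paperfolding_rec ..
qed

lemma paperfolding_eq: "paperfolding = (\<lambda>n. of_bool (pf n))"
proof
  fix n
  have "paperfolding n < 2"
  proof (induction n rule: less_induct)
    case (less n)
    then show ?case by (subst paperfolding.simps) (auto elim!: oddE)
  qed
  then show "paperfolding n = of_bool (pf n)" by (auto simp: pf_def)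
qed

lemma pf_numeral [simp]:
  "pf (numeral (Num.Bit0 k)) \<longleftrightarrow> odd (numeral k :: nat)"
  "pf (numeral (Num.Bit1 k)) \<longleftrightarrow> pf (numeral k)"
  "\<not> pf 0" "\<not> pf 1" "\<not> pf (Suc 0)" "pf (Suc (Suc 0))" "\<not> pf (Suc (Suc (Suc 0)))"
proof -
  show "pf (numeral (Num.Bit0 k)) \<longleftrightarrow> odd (numeral k :: nat)"
    using pf_rec(1)[of "numeral k"] by simp
  show "pf (numeral (Num.Bit1 k)) \<longleftrightarrow> pf (numeral k)"
    using pf_rec(2)[of "numeral k"] by simp
  show "\<not> pf 0" "\<not> pf 1" "\<not> pf (Suc 0)" "pf (Suc (Suc 0))" "\<not> pf (Suc (Suc (Suc 0)))"
    using pf_rec(1)[of 0] pf_rec(2)[of 0] pf_rec(1)[of 1] pf_rec(2)[of 1]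
    by (simp_all add: numeral_2_eq_2)
qed

section \<open>Paperfolding: distances at which a window can recur\<close>

lemma pf_div: "pf x \<longleftrightarrow> (if odd x then pf (x div 2) else odd (x div 2))"
  using pf_rec[of "x div 2"] by (cases "even x") (auto elim!: evenE oddE)

text \<open>At even positions the letter depends on x modulo 4 only, so a shift by 2d with d even
  agrees there automatically. Only odd positions constrain, which is why the right end is b div 2
  and not (b + 1) div 2.\<close>

lemma pf_matches_double:
  assumes "even d"
  shows "matches pf (2 * d) a b \<longleftrightarrow> matches pf d (a div 2) (b div 2)"
proof -
  have *: "pf x = pf (x + 2 * d) \<longleftrightarrow> (odd x \<longrightarrow> pf (x div 2) = pf (x div 2 + d))" for x
  proof -
    have "(x + 2 * d) div 2 = x div 2 + d" "odd (x + 2 * d) \<longleftrightarrow> odd x"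
      "odd (x div 2 + d) \<longleftrightarrow> odd (x div 2)" using assms by auto
    then show ?thesis using pf_div[of x] pf_div[of "x + 2 * d"] by metis
  qed
  show ?thesis
  proof
    assume m: "matches pf (2 * d) a b"
    show "matches pf d (a div 2) (b div 2)"
      unfolding matches_def
    proof (intro allI impI)
      fix y assume "a div 2 \<le> y" "y < b div 2"
      then have "pf (2 * y + 1) = pf (2 * y + 1 + 2 * d)" using m unfolding matches_def by auto
      then show "pf y = pf (y + d)" using *[of "2 * y + 1"] by simp
    qed
  next
    assume m: "matches pf d (a div 2) (b div 2)"
    show "matches pf (2 * d) a b"
      unfolding matches_def *
    proof (intro allI impI)
      fix x assume "a \<le> x" "x < b" "odd x"
      then have "a div 2 \<le> x div 2" "x div 2 < b div 2" by (auto elim!: oddE)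
      then show "pf (x div 2) = pf (x div 2 + d)" using m unfolding matches_def by blast
    qed
  qed
qed

lemma pf_even: "even x \<Longrightarrow> pf x \<longleftrightarrow> odd (x div 2)"
  by (simp add: pf_div)

lemma pf_mod_4: "x mod 4 = 1 \<Longrightarrow> pf x \<longleftrightarrow> odd (x div 4)"
proof -
  assume x: "x mod 4 = 1"
  then have "odd x" "even (x div 2)" "x div 2 div 2 = x div 4" by presburger+
  then show ?thesis using pf_div[of x] pf_div[of "x div 2"] by simp
qed

text \<open>Two letters contain an even position, and a shift congruent to 2 modulo 4 flips its
  letter.\<close>

lemma pf_matches_even_4_dvd:
  assumes m: "matches pf d a b" and "a + 2 \<le> b" "even d"
  shows "4 dvd d"
proof (rule ccontr)
  assume "\<not> 4 dvd d"
  then have d: "odd (d div 2)" using assms(3) by (auto elim!: evenE)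
  define x where "x = 2 * ((a + 1) div 2)"
  have x: "a \<le> x" "x < b" "even x" "even (x + d)" using assms unfolding x_def by auto
  have "(x + d) div 2 = x div 2 + d div 2" using x assms(3) by (auto elim!: evenE)
  then have "odd ((x + d) div 2) \<noteq> odd (x div 2)" using d by simp
  moreover have "pf x = pf (x + d)" using m x unfolding matches_def by auto
  ultimately show False using pf_even x by metis
qed

text \<open>Translation by 4 fixes letters at even positions and flips those at positions congruent
  to 1 modulo 4. An odd shift maps one kind onto the other for some x among the first three
  positions, and x + 4 still lies in a window of 7 letters.\<close>

lemma pf_matches_4_dvd:
  assumes m: "matches pf d a b" and "a + 7 \<le> b"
  shows "4 dvd d"
proof (cases "even d")
  case True
  then show ?thesis using pf_matches_even_4_dvd[OF m] assms(2) by simp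
next
  case odd: False
  have "\<exists>x. (x = a \<or> x = a + 1 \<or> x = a + 2) \<and>
      (x mod 4 = 1 \<or> even x \<and> (x + d) mod 4 = 1)"
    using odd by presburger
  then obtain x where "x = a \<or> x = a + 1 \<or> x = a + 2"
    and *: "x mod 4 = 1 \<or> even x \<and> (x + d) mod 4 = 1" by blast
  then have x: "a \<le> x" "x + 4 < b" using assms(2) by auto
  have eq: "pf x = pf (x + d)" "pf (x + 4) = pf (x + d + 4)"
    using m x unfolding matches_def by (auto simp: ac_simps)
  have c4: "pf y \<noteq> pf (y + 4)" if "y mod 4 = 1" for y
    using pf_mod_4[of y] pf_mod_4[of "y + 4"] that div_add_self2[of 4 y] by simp
  have c2: "pf y = pf (y + 4)" if "even y" for y
    using pf_even[of y] pf_even[of "y + 4"] that by simp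
  from * show ?thesis
  proof
    assume "x mod 4 = 1"
    moreover from this have "even (x + d)" using odd by presburger
    ultimately show ?thesis using c4[of x] c2[of "x + d"] eq by blast
  next
    assume "even x \<and> (x + d) mod 4 = 1"
    then show ?thesis using c2[of x] c4[of "x + d"] eq by blast
  qed
qed

lemma pf_matches_power_dvd:
  assumes "matches pf d a b" "a + 2 ^ Suc j \<le> b" "even d"
  shows "2 ^ Suc (Suc j) dvd d"
  using assms
proof (induction j arbitrary: d a b)
  case 0
  then show ?case using pf_matches_even_4_dvd[of d a b] by simp
next
  case (Suc j)
  have "4 dvd d"
  proof (rule pf_matches_even_4_dvd[OF Suc.prems(1)])
    have "0 < (2 :: nat) ^ j" by simp
    then show "a + 2 \<le> b" using Suc.prems(2) unfolding power_Suc by linarith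
  qed (use Suc.prems in simp)
  then obtain e where e: "d = 2 * e" "even e" by (auto elim!: dvdE)
  have "matches pf e (a div 2) (b div 2)"
    using Suc.prems(1) pf_matches_double[OF e(2)] e(1) by simp
  moreover have "a div 2 + 2 ^ Suc j \<le> b div 2" using Suc.prems(2) by auto
  ultimately have "2 ^ Suc (Suc j) dvd e" using Suc.IH e(2) by blast
  then show ?case using e(1) by simp
qed

text \<open>Returns double as for Rudin-Shapiro, from the base fact that each letter recurs at an
  even distance of at most 8.\<close>

lemma pf_return: "\<exists>d. 0 < d \<and> d \<le> 8 * 2 ^ j \<and> even d \<and> matches pf d a (a + 2 ^ j)"
proof (induction j arbitrary: a)
  case 0
  have "\<exists>d. 0 < d \<and> d \<le> 8 \<and> even d \<and> pf a = pf (a + d)"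
  proof (cases "even a")
    case True
    then have "pf a = pf (a + 4)" using pf_even[of a] pf_even[of "a + 4"] by simp
    then show ?thesis by (intro exI[of _ 4]) simp
  next
    case False
    then obtain y where y: "a = 2 * y + 1" by (rule oddE)
    \<comment> \<open>The even one of y + 1 and y + 2. The letters at z and z + 2 differ, so one of
      them equals the letter at y.\<close>
    define z where "z = 2 * ((y + 2) div 2)"
    have z: "y < z" "z \<le> y + 2" "even z" unfolding z_def by auto
    have "pf z \<noteq> pf (z + 2)" using pf_even[of z] pf_even[of "z + 2"] z by simp
    then obtain e where e: "0 < e" "e \<le> 4" "pf y = pf (y + e)"
      using z that[of "z - y"] that[of "z + 2 - y"] by (cases "pf y = pf z") auto
    then have "pf a = pf (a + 2 * e)" using pf_rec(2)[of y] pf_rec(2)[of "y + e"] y by simp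
    then show ?thesis using e by (intro exI[of _ "2 * e"]) simp
  qed
  then show ?case by (auto simp: matches_def less_Suc_eq_le dest!: le_antisym)
next
  case (Suc j)
  obtain d where d: "0 < d" "d \<le> 8 * 2 ^ j" "even d"
      "matches pf d (a div 2) (a div 2 + 2 ^ j)" using Suc by blast
  have "(a + 2 ^ Suc j) div 2 = a div 2 + 2 ^ j" by auto
  then have "matches pf (2 * d) a (a + 2 ^ Suc j)"
    using d(4) by (simp only: pf_matches_double[OF d(3)])
  then show ?case using d by (intro exI[of _ "2 * d"]) simp
qed

lemma pf_first_return_le:
  assumes "first_return pf p a b" "b \<le> a + 2 ^ j"
  shows "p \<le> 8 * 2 ^ j"
proof -
  obtain d where d: "0 < d" "d \<le> 8 * 2 ^ j" "matches pf d a (a + 2 ^ j)"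
    using pf_return by blast
  then have "matches pf d a b" using assms(2) by (auto elim: matches_mono)
  then show ?thesis using assms(1) d unfolding first_return_def by (meson not_le_imp_less order.trans)
qed

text \<open>Toeplitz structure: all blocks of length 2 2^t agree except at two holes. The letter
  just before the middle alternates with the block index, and the last letter of block c is letter c
  of the sequence itself.\<close>

lemma pf_block:
  assumes "j < 2 * 2 ^ t"
  shows "pf (2 * 2 ^ t * c + j) \<longleftrightarrow>
    (if j + 1 = 2 ^ t then odd c else if j + 1 = 2 * 2 ^ t then pf c else pf j)"
  using assms
proof (induction t arbitrary: j)
  case 0
  then consider "j = 0" | "j = 1" by force
  then show ?case using pf_rec[of c] by cases auto
next
  case (Suc t)
  let ?x = "2 * 2 ^ Suc t * c + j"
  have x: "?x div 2 = 2 * 2 ^ t * c + j div 2" "odd ?x \<longleftrightarrow> odd j" by auto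
  show ?case
  proof (cases "even j")
    case True
    then have "odd (?x div 2) \<longleftrightarrow> odd (j div 2)" using x by simp
    moreover have "j + 1 \<noteq> 2 ^ Suc t" "j + 1 \<noteq> 2 * 2 ^ Suc t" using True
      by (metis even_add odd_one even_mult_iff even_numeral power_Suc)+
    ultimately show ?thesis using pf_div[of ?x] pf_div[of j] x True by simp
  next
    case False
    have "j div 2 < 2 * 2 ^ t" using Suc.prems by auto
    moreover have "j div 2 + 1 = 2 ^ t \<longleftrightarrow> j + 1 = 2 ^ Suc t"
      "j div 2 + 1 = 2 * 2 ^ t \<longleftrightarrow> j + 1 = 2 * 2 ^ Suc t" using False by (auto elim!: oddE)
    ultimately show ?thesis
      using Suc.IH[of "j div 2"] pf_div[of ?x] pf_div[of j] x False by metis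
  qed
qed

text \<open>Letters \<open>2q \<le> x < 6q\<close> of \<open>pf_pair q p v w\<close>, with \<open>q\<close> a power of 2, are two consecutive blocks
  of length \<open>2q\<close> of the sequence, with last letters \<open>v\<close> and \<open>w\<close>, where the index of the first
  block has parity \<open>p\<close>.\<close>

definition pf_pair :: "nat \<Rightarrow> bool \<Rightarrow> bool \<Rightarrow> bool \<Rightarrow> nat \<Rightarrow> bool" where
  "pf_pair q p v w x \<longleftrightarrow>
     (if x = 3 * q - 1 then p else if x = 4 * q - 1 then v
      else if x = 5 * q - 1 then \<not> p else if x = 6 * q - 1 then w else pf x)"

lemma pf_pair:
  assumes q: "q = 2 ^ t" and j: "j < 4 * q"
  shows "pf (2 * q * c + j) \<longleftrightarrow> pf_pair q (odd c) (pf c) (pf (Suc c)) (2 * q + j)"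
proof (cases "j < 2 * q")
  case True
  have "2 * q + j = 3 * q - 1 \<longleftrightarrow> j + 1 = q" "2 * q + j = 4 * q - 1 \<longleftrightarrow> j + 1 = 2 * q"
    "2 * q + j \<noteq> 5 * q - 1" "2 * q + j \<noteq> 6 * q - 1" using True q by auto
  then show ?thesis
    using pf_block[of j t c] pf_block[of j t 1] q True by (simp add: pf_pair_def)
next
  case False
  define i where "i = j - 2 * q"
  have i: "j = 2 * q + i" "i < 2 * q" using False j by (auto simp: i_def)
  have e: "2 * q * c + j = 2 * q * Suc c + i" "2 * q + j = 2 * q * 2 + i" using i by simp_all
  have 1: "pf (2 * q + j) \<longleftrightarrow> (if i + 1 = q then False else if i + 1 = 2 * q then True else pf i)"
    unfolding e(2) using pf_block[of i t 2] i(2) q by simp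
  have 2: "pf (2 * q * c + j) \<longleftrightarrow>
      (if i + 1 = q then even c else if i + 1 = 2 * q then pf (Suc c) else pf i)"
    unfolding e(1) using pf_block[of i t "Suc c"] i(2) q by simp
  have "2 * q + j = 5 * q - 1 \<longleftrightarrow> i + 1 = q" "2 * q + j = 6 * q - 1 \<longleftrightarrow> i + 1 = 2 * q"
    "2 * q + j \<noteq> 3 * q - 1" "2 * q + j \<noteq> 4 * q - 1" using False i by auto
  then show ?thesis unfolding pf_pair_def 1 2 by simp
qed

lemma pf_not_first_return:
  assumes c: "\<And>p v w. no_first_return (pf_pair q p v w) m d (2 * q) (4 * q)"
    and q: "q = 2 ^ t" "d + m \<le> 2 * q"
  shows "\<not> first_return pf d a (a + m)"
proof -
  define c where "c = a div (2 * q)"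
  define s where "s = a mod (2 * q)"
  have s: "a = 2 * q * c + s" "s < 2 * q" using q by (simp_all add: c_def s_def)
  have "inj (\<lambda>x. x :: bool)" by (auto simp: inj_def)
  then show ?thesis unfolding s(1)
    by (rule not_first_return_transfer[OF assms(1)[of "odd c" "pf c" "pf (Suc c)"], rotated])
      (use s q pf_pair[OF q(1)] in auto)
qed

lemma pf_pair_numeral:
  "pf_pair 16 p v w (numeral x) \<longleftrightarrow>
    (if numeral x = (47 :: nat) then p else if numeral x = (63 :: nat) then v
     else if numeral x = (79 :: nat) then \<not> p else if numeral x = (95 :: nat) then w
     else pf (numeral x))"
  "pf_pair 32 p v w (numeral x) \<longleftrightarrow>
    (if numeral x = (95 :: nat) then p else if numeral x = (127 :: nat) then v
     else if numeral x = (159 :: nat) then \<not> p else if numeral x = (191 :: nat) then w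
     else pf (numeral x))"
  "pf_pair 64 p v w (numeral x) \<longleftrightarrow>
    (if numeral x = (191 :: nat) then p else if numeral x = (255 :: nat) then v
     else if numeral x = (319 :: nat) then \<not> p else if numeral x = (383 :: nat) then w
     else pf (numeral x))"
  by (simp_all add: pf_pair_def)

text \<open>The pairs left open by the return bound and by divisibility; except for the first, the
  distance is odd and the window shorter than 7 letters.\<close>

lemma pf_no_first_return:
  "\<not> first_return pf 16 a (a + 2)" "\<not> first_return pf 13 a (a + 5)" "\<not> first_return pf 15 a (a + 3)"
  "\<not> first_return pf 29 a (a + 3)" "\<not> first_return pf 31 a (a + 3)"
  "\<not> first_return pf 29 a (a + 4)" "\<not> first_return pf 27 a (a + 5)"
  "\<not> first_return pf 29 a (a + 5)" "\<not> first_return pf 27 a (a + 6)"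
  "\<not> first_return pf 59 a (a + 5)" "\<not> first_return pf 61 a (a + 5)"
  "\<not> first_return pf 63 a (a + 5)" "\<not> first_return pf 59 a (a + 6)" "\<not> first_return pf 61 a (a + 6)"
proof -
  have "no_first_return (pf_pair 16 p v w) 2 16 (2 * 16) (4 * 16)" for p v w
    by (cases p; cases v; cases w; simp add: search_simps pf_pair_numeral)
  from pf_not_first_return[OF this, of 4] show "\<not> first_return pf 16 a (a + 2)" by simp
  have "no_first_return (pf_pair 16 p v w) 5 13 (2 * 16) (4 * 16)" for p v w
    by (cases p; cases v; cases w; simp add: search_simps pf_pair_numeral)
  from pf_not_first_return[OF this, of 4] show "\<not> first_return pf 13 a (a + 5)" by simp
  have "no_first_return (pf_pair 16 p v w) 3 15 (2 * 16) (4 * 16)" for p v w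
    by (cases p; cases v; cases w; simp add: search_simps pf_pair_numeral)
  from pf_not_first_return[OF this, of 4] show "\<not> first_return pf 15 a (a + 3)" by simp
  have "no_first_return (pf_pair 32 p v w) 3 29 (2 * 32) (4 * 32)" for p v w
    by (cases p; cases v; cases w; simp add: search_simps pf_pair_numeral)
  from pf_not_first_return[OF this, of 5] show "\<not> first_return pf 29 a (a + 3)" by simp
  have "no_first_return (pf_pair 32 p v w) 3 31 (2 * 32) (4 * 32)" for p v w
    by (cases p; cases v; cases w; simp add: search_simps pf_pair_numeral)
  from pf_not_first_return[OF this, of 5] show "\<not> first_return pf 31 a (a + 3)" by simp
  have "no_first_return (pf_pair 32 p v w) 4 29 (2 * 32) (4 * 32)" for p v w
    by (cases p; cases v; cases w; simp add: search_simps pf_pair_numeral)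
  from pf_not_first_return[OF this, of 5] show "\<not> first_return pf 29 a (a + 4)" by simp
  have "no_first_return (pf_pair 32 p v w) 5 27 (2 * 32) (4 * 32)" for p v w
    by (cases p; cases v; cases w; simp add: search_simps pf_pair_numeral)
  from pf_not_first_return[OF this, of 5] show "\<not> first_return pf 27 a (a + 5)" by simp
  have "no_first_return (pf_pair 32 p v w) 5 29 (2 * 32) (4 * 32)" for p v w
    by (cases p; cases v; cases w; simp add: search_simps pf_pair_numeral)
  from pf_not_first_return[OF this, of 5] show "\<not> first_return pf 29 a (a + 5)" by simp
  have "no_first_return (pf_pair 32 p v w) 6 27 (2 * 32) (4 * 32)" for p v w
    by (cases p; cases v; cases w; simp add: search_simps pf_pair_numeral)
  from pf_not_first_return[OF this, of 5] show "\<not> first_return pf 27 a (a + 6)" by simp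
  have "no_first_return (pf_pair 64 p v w) 5 59 (2 * 64) (4 * 64)" for p v w
    by (cases p; cases v; cases w; simp add: search_simps pf_pair_numeral)
  from pf_not_first_return[OF this, of 6] show "\<not> first_return pf 59 a (a + 5)" by simp
  have "no_first_return (pf_pair 64 p v w) 5 61 (2 * 64) (4 * 64)" for p v w
    by (cases p; cases v; cases w; simp add: search_simps pf_pair_numeral)
  from pf_not_first_return[OF this, of 6] show "\<not> first_return pf 61 a (a + 5)" by simp
  have "no_first_return (pf_pair 64 p v w) 5 63 (2 * 64) (4 * 64)" for p v w
    by (cases p; cases v; cases w; simp add: search_simps pf_pair_numeral)
  from pf_not_first_return[OF this, of 6] show "\<not> first_return pf 63 a (a + 5)" by simp
  have "no_first_return (pf_pair 64 p v w) 6 59 (2 * 64) (4 * 64)" for p v w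
    by (cases p; cases v; cases w; simp add: search_simps pf_pair_numeral)
  from pf_not_first_return[OF this, of 6] show "\<not> first_return pf 59 a (a + 6)" by simp
  have "no_first_return (pf_pair 64 p v w) 6 61 (2 * 64) (4 * 64)" for p v w
    by (cases p; cases v; cases w; simp add: search_simps pf_pair_numeral)
  from pf_not_first_return[OF this, of 6] show "\<not> first_return pf 61 a (a + 6)" by simp
qed

section \<open>Paperfolding: lengths without closed factors\<close>

lemma pf_first_return_power_dvd:
  assumes r: "first_return pf p a (a + m)" and m: "2 ^ Suc j \<le> m" and p: "even p \<or> 7 \<le> m"
  shows "2 ^ Suc (Suc j) dvd p"
proof -
  have r': "matches pf p a (a + m)" using r by (simp add: first_return_def)
  have "4 dvd p" if "7 \<le> m" using pf_matches_4_dvd[OF r'] that by simp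
  then have "even p" using p by presburger
  then show ?thesis using pf_matches_power_dvd[OF r'] m by simp
qed

text \<open>As for Rudin-Shapiro, with K = 2^(k-4) and returns within 8 K for m <= K. Divisibility
  of p by 2^(j+1) now holds for 2^j <= m < 2^(j+1); the strict inequality makes p + m < 2^k, so 2^k
  itself is excluded too.\<close>

lemma pf_excluded:
  assumes r: "first_return pf p a (a + m)" and k: "5 \<le> k"
    and n: "2 ^ k \<le> p + m" "p + m \<le> 2 ^ k + 2 ^ (k - 4)"
  shows False
proof -
  define i where "i = k - 4"
  define K where "K = (2 :: nat) ^ i"
  have i: "1 \<le> i" "k = i + 4" using k by (auto simp: i_def)
  have K: "16 * K \<le> p + m" "p + m \<le> 17 * K" "2 \<le> K"
  proof -
    have "2 ^ 1 \<le> (2 :: nat) ^ i" using i(1) by (intro power_increasing) auto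
    then show "2 \<le> K" by (simp add: K_def)
    show "16 * K \<le> p + m" "p + m \<le> 17 * K" using n by (simp_all add: K_def i(2) power_add)
  qed
  have "0 < p" "0 < m" using r by (simp_all add: first_return_def)
  show False
  proof (cases "m \<le> K")
    case True
    then have "p \<le> 8 * K" using pf_first_return_le[OF r, of i] by (simp add: K_def)
    then show False using True K by linarith
  next
    case False
    obtain j where j: "2 ^ j \<le> m" "m < 2 * 2 ^ j" using \<open>0 < m\<close> by (rule power_of_2_between)
    have ij: "i \<le> j"
    proof (rule ccontr)
      assume "\<not> i \<le> j"
      then have "(2 :: nat) ^ Suc j \<le> 2 ^ i" by (intro power_increasing) auto
      then show False using j(2) False by (simp add: K_def)
    qed
    then obtain j' where j': "j = Suc j'" using i(1) by (cases j) auto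
    have "even p \<or> 7 \<le> m"
    proof (rule ccontr)
      assume *: "\<not> (even p \<or> 7 \<le> m)"
      then have "K < 6" using False by simp
      \<comment> \<open>Odd distances need windows of at most 6 letters, which leaves only k = 5 and
        k = 6.\<close>
      have "i = 1 \<or> i = 2"
      proof (rule ccontr)
        assume "\<not> (i = 1 \<or> i = 2)"
        then have "2 ^ 3 \<le> (2 :: nat) ^ i" using i(1) by (intro power_increasing) auto
        then show False using \<open>K < 6\<close> by (simp add: K_def)
      qed
      then show False
      proof
        assume "i = 1"
        then have "K = 2" by (simp add: K_def)
        then have "m = 3 \<and> (p = 29 \<or> p = 31) \<or> m = 4 \<and> p = 29 \<or> m = 5 \<and> (p = 27 \<or> p = 29)
            \<or> m = 6 \<and> p = 27"
          using * False K by presburger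
        then show False using r pf_no_first_return by auto
      next
        assume "i = 2"
        then have "K = 4" by (simp add: K_def)
        then have "m = 5 \<and> (p = 59 \<or> p = 61 \<or> p = 63) \<or> m = 6 \<and> (p = 59 \<or> p = 61)"
          using * False K by presburger
        then show False using r pf_no_first_return by auto
      qed
    qed
    then have d: "2 ^ Suc j dvd p"
      using pf_first_return_power_dvd[OF r, of j'] j(1) unfolding j' by blast
    have p: "p < 16 * K" using False K by linarith
    show False
    proof (cases "j < i + 4")
      case True
      then have "2 ^ Suc j dvd (2 :: nat) ^ (i + 4)" by (intro le_imp_power_dvd) simp
      then have "2 ^ Suc j dvd 16 * K - p" using d by (auto intro!: dvd_diff_nat simp: K_def power_add)
      then have "2 ^ Suc j \<le> 16 * K - p" using p by (intro dvd_imp_le) auto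
      then show False using j(2) K p unfolding power_Suc by linarith
    next
      case False
      then have "(2 :: nat) ^ (i + 4) \<le> 2 ^ Suc j" by (intro power_increasing) auto
      moreover have "2 ^ Suc j \<le> p" using d \<open>0 < p\<close> by (intro dvd_imp_le) auto
      ultimately show False using p by (simp add: K_def power_add)
    qed
  qed
qed

lemma pf_excluded_18:
  assumes r: "first_return pf p a (a + m)"
  shows "p + m \<noteq> 18"
proof
  assume n: "p + m = 18"
  have pos: "0 < p" "0 < m" using r by (simp_all add: first_return_def)
  have "p \<le> 8" if "m \<le> 1" using pf_first_return_le[OF r, of 0] that by simp
  moreover have "8 dvd p" if "4 \<le> m" "even p \<or> 7 \<le> m"
    using pf_first_return_power_dvd[OF r, of 1] that by simp
  moreover have "16 dvd p" if "8 \<le> m" using pf_first_return_power_dvd[OF r, of 2] that by simp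
  moreover have "32 dvd p" if "16 \<le> m" using pf_first_return_power_dvd[OF r, of 3] that by simp
  moreover have "\<not> (m = 2 \<and> p = 16)" "\<not> (m = 3 \<and> p = 15)" "\<not> (m = 5 \<and> p = 13)"
    using r pf_no_first_return by auto
  note facts = calculation this
  consider "m \<le> 1" | "m = 2" | "m = 3" | "m = 4" | "m = 5" | "m = 6" | "m = 7"
    | "8 \<le> m" "m \<le> 15" | "16 \<le> m" by linarith
  then show False using facts n pos by cases (simp_all, presburger+)
qed

text \<open>Three families with the same distance 64 2^j but different windows give the lengths from
  68 2^j + 1 to 72 2^j, from 72 2^j + 1 to 96 2^j - 1, and from 95 2^j + 1 to 128 2^j - 1: all
  between the excluded interval and the next power of two.\<close>

lemma pf_family1:
  shows "first_return pf (64 * 2 ^ j) (108 * 2 ^ j - 1) (112 * 2 ^ j)"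
    and "matches pf (64 * 2 ^ j) (104 * 2 ^ j) (112 * 2 ^ j)"
proof (induction j)
  case 0
  show "first_return pf (64 * 2 ^ 0) (108 * 2 ^ 0 - 1) (112 * 2 ^ 0)"
    and "matches pf (64 * 2 ^ 0) (104 * 2 ^ 0) (112 * 2 ^ 0)"
    by (simp_all add: first_return_code matches_code upt_eval)
next
  case (Suc j)
  have half: "(108 * 2 ^ Suc j - 1 :: nat) div 2 = 108 * 2 ^ j - 1"
    "(112 * 2 ^ Suc j :: nat) div 2 = 112 * 2 ^ j"
    "(112 * 2 ^ Suc j :: nat) div 2 = 112 * 2 ^ j" "(104 * 2 ^ Suc j :: nat) div 2 = 104 * 2 ^ j"
    by auto
  show "matches pf (64 * 2 ^ Suc j) (104 * 2 ^ Suc j) (112 * 2 ^ Suc j)"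
    using Suc(2) pf_matches_double[of "64 * 2 ^ j" "104 * 2 ^ Suc j" "(112 * 2 ^ Suc j)"] unfolding half by simp
  have eq: "matches pf (2 * d) (108 * 2 ^ Suc j - 1) (112 * 2 ^ Suc j) \<longleftrightarrow>
      matches pf d (108 * 2 ^ j - 1) (112 * 2 ^ j)" if "even d" for d
    unfolding pf_matches_double[OF that] half ..
  have j: "2 \<le> (2 :: nat) ^ Suc j" by simp
  show "first_return pf (64 * 2 ^ Suc j) (108 * 2 ^ Suc j - 1) (112 * 2 ^ Suc j)"
    unfolding first_return_def
  proof (intro conjI allI impI)
    show "matches pf (64 * 2 ^ Suc j) (108 * 2 ^ Suc j - 1) (112 * 2 ^ Suc j)"
      using Suc(1) eq[of "64 * 2 ^ j"] by (simp add: first_return_def)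
    fix d :: nat assume d: "0 < d" "d < 64 * 2 ^ Suc j"
    show "\<not> matches pf d (108 * 2 ^ Suc j - 1) (112 * 2 ^ Suc j)"
    proof
      assume m: "matches pf d (108 * 2 ^ Suc j - 1) (112 * 2 ^ Suc j)"
      then have "4 dvd d" by (rule pf_matches_4_dvd) (use j in linarith)
      then obtain e where "d = 2 * e" "even e" by (auto elim!: dvdE)
      then show False using m eq[of e] Suc(1) d by (simp add: first_return_def)
    qed
  qed (use j in linarith)+
qed

lemma pf_closed1:
  assumes "68 * 2 ^ j + 1 \<le> n" "n \<le> 72 * 2 ^ j"
  shows "has_closed_factor pf n"
proof -
  have "112 * 2 ^ j - (108 * 2 ^ j - 1) = 4 * 2 ^ j + (1 :: nat)" "(104 * 2 ^ j) \<le> 108 * 2 ^ j - (1 :: nat)"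
    "112 * 2 ^ j \<le> ((112 * 2 ^ j) :: nat)"
    using one_le_power[of "2 :: nat" j] by linarith+
  then show ?thesis
    using has_closed_factor_range[OF pf_family1(1) pf_family1(2)[of j], of n] assms by simp
qed

lemma pf_family2:
  shows "first_return pf (64 * 2 ^ j) (8 * 2 ^ j - 1) (16 * 2 ^ j)"
    and "matches pf (64 * 2 ^ j) 0 (32 * 2 ^ j - 1)"
proof (induction j)
  case 0
  show "first_return pf (64 * 2 ^ 0) (8 * 2 ^ 0 - 1) (16 * 2 ^ 0)"
    and "matches pf (64 * 2 ^ 0) 0 (32 * 2 ^ 0 - 1)"
    by (simp_all add: first_return_code matches_code upt_eval)
next
  case (Suc j)
  have half: "(8 * 2 ^ Suc j - 1 :: nat) div 2 = 8 * 2 ^ j - 1"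
    "(16 * 2 ^ Suc j :: nat) div 2 = 16 * 2 ^ j"
    "(32 * 2 ^ Suc j - 1 :: nat) div 2 = 32 * 2 ^ j - 1"
    by auto
  show "matches pf (64 * 2 ^ Suc j) 0 (32 * 2 ^ Suc j - 1)"
    using Suc(2) pf_matches_double[of "64 * 2 ^ j" 0 "(32 * 2 ^ Suc j - 1)"] unfolding half by simp
  have eq: "matches pf (2 * d) (8 * 2 ^ Suc j - 1) (16 * 2 ^ Suc j) \<longleftrightarrow>
      matches pf d (8 * 2 ^ j - 1) (16 * 2 ^ j)" if "even d" for d
    unfolding pf_matches_double[OF that] half ..
  have j: "2 \<le> (2 :: nat) ^ Suc j" by simp
  show "first_return pf (64 * 2 ^ Suc j) (8 * 2 ^ Suc j - 1) (16 * 2 ^ Suc j)"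
    unfolding first_return_def
  proof (intro conjI allI impI)
    show "matches pf (64 * 2 ^ Suc j) (8 * 2 ^ Suc j - 1) (16 * 2 ^ Suc j)"
      using Suc(1) eq[of "64 * 2 ^ j"] by (simp add: first_return_def)
    fix d :: nat assume d: "0 < d" "d < 64 * 2 ^ Suc j"
    show "\<not> matches pf d (8 * 2 ^ Suc j - 1) (16 * 2 ^ Suc j)"
    proof
      assume m: "matches pf d (8 * 2 ^ Suc j - 1) (16 * 2 ^ Suc j)"
      then have "4 dvd d" by (rule pf_matches_4_dvd) (use j in linarith)
      then obtain e where "d = 2 * e" "even e" by (auto elim!: dvdE)
      then show False using m eq[of e] Suc(1) d by (simp add: first_return_def)
    qed
  qed (use j in linarith)+
qed

lemma pf_closed2:
  assumes "72 * 2 ^ j + 1 \<le> n" "n \<le> 96 * 2 ^ j - 1"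
  shows "has_closed_factor pf n"
proof -
  have "16 * 2 ^ j - (8 * 2 ^ j - 1) = 8 * 2 ^ j + (1 :: nat)" "0 \<le> 8 * 2 ^ j - (1 :: nat)"
    "16 * 2 ^ j \<le> ((32 * 2 ^ j - 1) :: nat)"
    using one_le_power[of "2 :: nat" j] by linarith+
  then show ?thesis
    using has_closed_factor_range[OF pf_family2(1) pf_family2(2)[of j], of n] assms by simp
qed

lemma pf_family3:
  shows "first_return pf (64 * 2 ^ j) (33 * 2 ^ j - 1) (64 * 2 ^ j)"
    and "matches pf (64 * 2 ^ j) (32 * 2 ^ j) (96 * 2 ^ j - 1)"
proof (induction j)
  case 0
  show "first_return pf (64 * 2 ^ 0) (33 * 2 ^ 0 - 1) (64 * 2 ^ 0)"
    and "matches pf (64 * 2 ^ 0) (32 * 2 ^ 0) (96 * 2 ^ 0 - 1)"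
    by (simp_all add: first_return_code matches_code upt_eval)
next
  case (Suc j)
  have half: "(33 * 2 ^ Suc j - 1 :: nat) div 2 = 33 * 2 ^ j - 1"
    "(64 * 2 ^ Suc j :: nat) div 2 = 64 * 2 ^ j"
    "(96 * 2 ^ Suc j - 1 :: nat) div 2 = 96 * 2 ^ j - 1" "(32 * 2 ^ Suc j :: nat) div 2 = 32 * 2 ^ j"
    by auto
  show "matches pf (64 * 2 ^ Suc j) (32 * 2 ^ Suc j) (96 * 2 ^ Suc j - 1)"
    using Suc(2) pf_matches_double[of "64 * 2 ^ j" "32 * 2 ^ Suc j" "(96 * 2 ^ Suc j - 1)"] unfolding half by simp
  have eq: "matches pf (2 * d) (33 * 2 ^ Suc j - 1) (64 * 2 ^ Suc j) \<longleftrightarrow>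
      matches pf d (33 * 2 ^ j - 1) (64 * 2 ^ j)" if "even d" for d
    unfolding pf_matches_double[OF that] half ..
  have j: "2 \<le> (2 :: nat) ^ Suc j" by simp
  show "first_return pf (64 * 2 ^ Suc j) (33 * 2 ^ Suc j - 1) (64 * 2 ^ Suc j)"
    unfolding first_return_def
  proof (intro conjI allI impI)
    show "matches pf (64 * 2 ^ Suc j) (33 * 2 ^ Suc j - 1) (64 * 2 ^ Suc j)"
      using Suc(1) eq[of "64 * 2 ^ j"] by (simp add: first_return_def)
    fix d :: nat assume d: "0 < d" "d < 64 * 2 ^ Suc j"
    show "\<not> matches pf d (33 * 2 ^ Suc j - 1) (64 * 2 ^ Suc j)"
    proof
      assume m: "matches pf d (33 * 2 ^ Suc j - 1) (64 * 2 ^ Suc j)"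
      then have "4 dvd d" by (rule pf_matches_4_dvd) (use j in linarith)
      then obtain e where "d = 2 * e" "even e" by (auto elim!: dvdE)
      then show False using m eq[of e] Suc(1) d by (simp add: first_return_def)
    qed
  qed (use j in linarith)+
qed

lemma pf_closed3:
  assumes "95 * 2 ^ j + 1 \<le> n" "n \<le> 128 * 2 ^ j - 1"
  shows "has_closed_factor pf n"
proof -
  have "64 * 2 ^ j - (33 * 2 ^ j - 1) = 31 * 2 ^ j + (1 :: nat)" "(32 * 2 ^ j) \<le> 33 * 2 ^ j - (1 :: nat)"
    "64 * 2 ^ j \<le> ((96 * 2 ^ j - 1) :: nat)"
    using one_le_power[of "2 :: nat" j] by linarith+
  then show ?thesis
    using has_closed_factor_range[OF pf_family3(1) pf_family3(2)[of j], of n] assms by simp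
qed

lemma pf_small:
  assumes "n < 64" "n \<noteq> 18" "n < 32 \<or> 34 < n"
  shows "has_closed_factor pf n"
proof -
  have r2: "has_closed_factor pf n" if "1 < n" "n \<le> 2"
    by (rule has_closed_factor_range[of pf 1 0 1 0 1])
      (use that in \<open>simp_all add: first_return_code matches_code upt_eval\<close>)
  have r3: "has_closed_factor pf n" if "2 < n" "n \<le> 3"
    by (rule has_closed_factor_range[of pf 2 1 2 1 2])
      (use that in \<open>simp_all add: first_return_code matches_code upt_eval\<close>)
  have r4: "has_closed_factor pf n" if "3 < n" "n \<le> 4"
    by (rule has_closed_factor_range[of pf 3 2 3 2 3])
      (use that in \<open>simp_all add: first_return_code matches_code upt_eval\<close>)
  have r5: "has_closed_factor pf n" if "4 < n" "n \<le> 6"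
    by (rule has_closed_factor_range[of pf 3 0 2 0 3])
      (use that in \<open>simp_all add: first_return_code matches_code upt_eval\<close>)
  have r7: "has_closed_factor pf n" if "6 < n" "n \<le> 7"
    by (rule has_closed_factor_range[of pf 4 2 5 2 5])
      (use that in \<open>simp_all add: first_return_code matches_code upt_eval\<close>)
  have r8: "has_closed_factor pf n" if "7 < n" "n \<le> 10"
    by (rule has_closed_factor_range[of pf 5 3 6 3 8])
      (use that in \<open>simp_all add: first_return_code matches_code upt_eval\<close>)
  have r11: "has_closed_factor pf n" if "10 < n" "n \<le> 15"
    by (rule has_closed_factor_range[of pf 8 6 9 4 11])
      (use that in \<open>simp_all add: first_return_code matches_code upt_eval\<close>)
  have r16: "has_closed_factor pf n" if "15 < n" "n \<le> 17"
    by (rule has_closed_factor_range[of pf 11 23 28 23 29])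
      (use that in \<open>simp_all add: first_return_code matches_code upt_eval\<close>)
  have r19: "has_closed_factor pf n" if "18 < n" "n \<le> 23"
    by (rule has_closed_factor_range[of pf 16 1 4 0 7])
      (use that in \<open>simp_all add: first_return_code matches_code upt_eval\<close>)
  have r24: "has_closed_factor pf n" if "23 < n" "n \<le> 31"
    by (rule has_closed_factor_range[of pf 16 8 16 8 23])
      (use that in \<open>simp_all add: first_return_code matches_code upt_eval\<close>)
  have r35: "has_closed_factor pf n" if "34 < n" "n \<le> 36"
    by (rule has_closed_factor_range[of pf 32 53 56 52 56])
      (use that in \<open>simp_all add: first_return_code matches_code upt_eval\<close>)
  have r37: "has_closed_factor pf n" if "36 < n" "n \<le> 47"
    by (rule has_closed_factor_range[of pf 32 7 12 0 15])
      (use that in \<open>simp_all add: first_return_code matches_code upt_eval\<close>)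
  have r48: "has_closed_factor pf n" if "47 < n" "n \<le> 63"
    by (rule has_closed_factor_range[of pf 32 16 32 16 47])
      (use that in \<open>simp_all add: first_return_code matches_code upt_eval\<close>)
  have r0: "has_closed_factor pf n" if "n \<le> 1" using that by (simp add: has_closed_factor_iff)
  show ?thesis
  proof (rule ccontr)
    assume c: "\<not> has_closed_factor pf n"
    then have "1 < n" using r0 by (metis not_le)
    then have "2 < n" using r2 c by (metis not_le)
    then have "3 < n" using r3 c by (metis not_le)
    then have "4 < n" using r4 c by (metis not_le)
    then have "6 < n" using r5 c by (metis not_le)
    then have "7 < n" using r7 c by (metis not_le)
    then have "10 < n" using r8 c by (metis not_le)
    then have "15 < n" using r11 c by (metis not_le)
    then have "17 < n" using r16 c by (metis not_le)
    then have "18 < n" using assms by linarith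
    then have "23 < n" using r19 c by (metis not_le)
    then have "31 < n" using r24 c by (metis not_le)
    then have "34 < n" using assms by linarith
    then have "36 < n" using r35 c by (metis not_le)
    then have "47 < n" using r37 c by (metis not_le)
    then have "63 < n" using r48 c by (metis not_le)
    then show False using assms by linarith
  qed
qed

lemma paperfolding_closed_iff:
  "has_closed_factor paperfolding n \<longleftrightarrow>
    n \<noteq> 18 \<and> \<not> (\<exists>k\<ge>5. 2 ^ k \<le> n \<and> n \<le> 2 ^ k + 2 ^ (k - 4))"
  (is "_ \<longleftrightarrow> ?P")
proof -
  have "has_closed_factor pf n \<longleftrightarrow> ?P"
  proof
    assume c: "has_closed_factor pf n"
    show ?P
    proof (cases "n \<le> 1")
      case True
      have "\<not> 2 ^ k \<le> n" if "5 \<le> k" for k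
        using True power_increasing[OF that, of "2 :: nat"] by simp
      then show ?thesis using True by auto
    next
      case False
      then obtain a b p where r: "first_return pf p a b" "n = p + (b - a)"
        using c unfolding has_closed_factor_iff by auto
      then have "b = a + (b - a)" by (simp add: first_return_def)
      then have "first_return pf p a (a + (b - a))" using r(1) by simp
      from pf_excluded[OF this] pf_excluded_18[OF this] show ?thesis
        unfolding r(2) by blast
    qed
  next
    assume P: ?P
    show "has_closed_factor pf n"
    proof (cases "n < 64")
      case True
      have "\<not> (2 ^ 5 \<le> n \<and> n \<le> 2 ^ 5 + 2 ^ (5 - 4))" using P by blast
      then show ?thesis using pf_small[of n] True P by auto
    next
      case False
      then have "0 < n div 64" by simp
      then obtain j where "2 ^ j \<le> n div 64" "n div 64 < 2 * 2 ^ j"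
        by (rule power_of_2_between)
      then have n: "64 * 2 ^ j \<le> n" "n < 128 * 2 ^ j" by linarith+
      have "5 \<le> j + 6" by simp
      then have "\<not> (2 ^ (j + 6) \<le> n \<and> n \<le> 2 ^ (j + 6) + 2 ^ (j + 6 - 4))"
        using P by blast
      moreover have "(2 :: nat) ^ (j + 6) = 64 * 2 ^ j" "(2 :: nat) ^ (j + 6 - 4) = 4 * 2 ^ j"
        by (simp_all add: power_add)
      ultimately have "68 * 2 ^ j < n" using n by simp
      then show ?thesis
        using pf_closed1[of j n] pf_closed2[of j n] pf_closed3[of j n] n
        by (cases "n \<le> 72 * 2 ^ j"; cases "n < 96 * 2 ^ j") auto
    qed
  qed
  then show ?thesis by (simp add: paperfolding_eq has_closed_factor_of_bool)
qed

section \<open>The automata\<close>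

definition state_of :: "'q dfa \<Rightarrow> nat \<Rightarrow> 'q option" where
  "state_of M n = run M (start M) (base2 n)"

lemma accepts_base2: "accepts M (base2 n) \<longleftrightarrow> (\<exists>q \<in> finals M. state_of M n = Some q)"
  by (simp add: accepts_def state_of_def)

lemma run_append: "run M q (v @ w) = Option.bind (run M q v) (\<lambda>q'. run M q' w)"
  by (induction v arbitrary: q) (auto split: option.split)

lemma state_of_0: "state_of M 0 = Some (start M)"
  by (simp add: state_of_def base2.simps)

lemma state_of_rec:
  "0 < n \<Longrightarrow> state_of M n = Option.bind (state_of M (n div 2)) (\<lambda>q. delta M q (odd n))"
proof -
  assume "0 < n"
  then have "base2 n = base2 (n div 2) @ [odd n]" by (subst base2.simps) simp
  then show ?thesis
    unfolding state_of_def
    by (cases "run M (start M) (base2 (n div 2))") (auto simp: run_append split: option.split)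
qed

lemma state_of_numeral:
  "state_of M (numeral (Num.Bit0 k)) =
    Option.bind (state_of M (numeral k)) (\<lambda>q. delta M q False)"
  "state_of M (numeral (Num.Bit1 k)) =
    Option.bind (state_of M (numeral k)) (\<lambda>q. delta M q True)"
  "state_of M (Suc 0) = delta M (start M) True"
  using state_of_rec[of "numeral (Num.Bit0 k)" M] state_of_rec[of "numeral (Num.Bit1 k)" M]
    state_of_rec[of "Suc 0" M] by (simp_all add: state_of_0)

section \<open>Automata given by transition tables\<close>

definition table_dfa :: "(nat option \<times> nat option) list \<Rightarrow> nat set \<Rightarrow> nat dfa" where
  "table_dfa T R = \<lparr>states = {..<length T}, start = length T - 1, finals = {..<length T} - R,
     delta = (\<lambda>q b. if q < length T then (if b then snd (T ! q) else fst (T ! q)) else None)\<rparr>"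

lemma is_dfa_table_dfa:
  assumes "T \<noteq> []" "list_all (\<lambda>(s, t). pred_option (\<lambda>q. q < length T) s \<and>
    pred_option (\<lambda>q. q < length T) t) T"
  shows "is_dfa (table_dfa T R)"
proof -
  have "q' < length T" if "q < length T" "(if b then snd (T ! q) else fst (T ! q)) = Some q'" for q b q'
    using assms(2) that unfolding list_all_length by (force simp: case_prod_beta split: if_splits)
  then show ?thesis
    using assms(1) by (auto simp: is_dfa_def table_dfa_def)
qed

lemma leading_power_eq:
  fixes n :: nat
  assumes "2 ^ j \<le> n" "n < 2 * 2 ^ j" "2 ^ k \<le> n" "n < 2 * 2 ^ k"
  shows "j = k"
proof -
  have "(2 :: nat) ^ j < 2 ^ Suc k" "(2 :: nat) ^ k < 2 ^ Suc j"
    using assms unfolding power_Suc by linarith+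
  then have "j < Suc k" "k < Suc j" by (simp_all only: power_strict_increasing_iff one_less_numeral_iff semiring_norm)
  then show ?thesis by simp
qed

text \<open>Turns the existential over k in the description of excluded lengths into a condition for
  the one k given by the leading bit of n.\<close>

lemma ex_ge_unique:
  fixes c K :: nat
  assumes "c \<le> K" "\<And>k. c \<le> k \<Longrightarrow> P k \<Longrightarrow> k = K"
  shows "(\<exists>k\<ge>c. P k) \<longleftrightarrow> P K"
  using assms by blast

text \<open>The states \<open>0, \<dots>, 13\<close> are those of 1, 2, 3, 4, 8, 16, 17, 32, 33, 35, 64, 65, 66, 132.\<close>

definition rs_dfa :: "nat dfa" where
  "rs_dfa = table_dfa
    [(Some 1, Some 2), (Some 3, Some 2), (Some 2, Some 2), (Some 4, Some 2), (Some 5, Some 6),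
     (Some 7, Some 8), (Some 2, Some 9), (Some 10, Some 11), (Some 12, Some 9), (Some 2, Some 2),
     (Some 10, None), (None, None), (Some 13, Some 9), (Some 13, Some 9), (None, Some 0)] {9, 13}"

lemma rs_dfa_simps:
  "states rs_dfa = {..<15}" "start rs_dfa = 14" "finals rs_dfa = {..<15} - {9, 13}"
proof -
  show states: "states rs_dfa = {..<15}" and "start rs_dfa = 14"
    by (simp_all add: rs_dfa_def table_dfa_def)
  have "finals rs_dfa = states rs_dfa - {9, 13}" by (simp add: rs_dfa_def table_dfa_def)
  then show "finals rs_dfa = {..<15} - {9, 13}" by (simp only: states)
qed

lemma rs_dfa_delta:
  "delta rs_dfa q b =
    (if q < 15 then
       (if b then [Some 2, Some 2, Some 2, Some 2, Some 6, Some 8, Some 9, Some 11, Some 9, Some 2,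
          None, None, Some 9, Some 9, Some 0] ! q
        else [Some 1, Some 3, Some 2, Some 4, Some 5, Some 7, Some 2, Some 10, Some 12, Some 2,
          Some 10, None, Some 13, Some 13, None] ! q)
     else None)"
proof (cases "q < 15")
  case True
  then have "q \<in> set [0..<15]" by simp
  then show ?thesis by (auto simp: rs_dfa_def table_dfa_def upt_eval)
qed (simp add: rs_dfa_def table_dfa_def)

lemma rs_dfa_less_128:
  assumes "n < 128"
  shows "(\<exists>q\<in>finals rs_dfa. state_of rs_dfa n = Some q) \<longleftrightarrow> n \<noteq> 35 \<and> n \<noteq> 67"
    and "64 \<le> n \<Longrightarrow> state_of rs_dfa n = Some (if n = 64 then 10 else if n = 65 then 11
      else if n = 66 then 12 else if n = 67 then 9 else 2)"
proof -
  have "list_all (\<lambda>n. (\<exists>q\<in>finals rs_dfa. state_of rs_dfa n = Some q) \<longleftrightarrow> n \<noteq> 35 \<and> n \<noteq> 67) [0..<128]"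
    by (simp add: upt_eval state_of_numeral state_of_0 rs_dfa_simps rs_dfa_delta)
  then show "(\<exists>q\<in>finals rs_dfa. state_of rs_dfa n = Some q) \<longleftrightarrow> n \<noteq> 35 \<and> n \<noteq> 67"
    using assms by (simp only: list_all_iff set_upt atLeastLessThan_iff le0 simp_thms)
  have "list_all (\<lambda>n. state_of rs_dfa n = Some (if n = 64 then 10 else if n = 65 then 11
      else if n = 66 then 12 else if n = 67 then 9 else 2)) [64..<128]"
    by (simp add: upt_eval state_of_numeral state_of_0 rs_dfa_simps rs_dfa_delta)
  then show "state_of rs_dfa n = Some (if n = 64 then 10 else if n = 65 then 11
      else if n = 66 then 12 else if n = 67 then 9 else 2)" if "64 \<le> n"
    using assms that by (simp only: list_all_iff set_upt atLeastLessThan_iff le0 simp_thms)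
qed

text \<open>The excluded interval ends at 132 2^j + 1. Doubling keeps 132 2^j in state 13 and sends
  its odd successor to state 9; both reject, but both successors of state 9 are the accepting sink
  2. The power 128 2^j keeps the accepting state 10, whose odd successor is missing.\<close>

lemma rs_dfa_state:
  assumes "128 * 2 ^ j \<le> n" "n < 256 * 2 ^ j"
  shows "state_of rs_dfa n =
    (if n = 128 * 2 ^ j then Some 10 else if n < 132 * 2 ^ j then None
     else if n = 132 * 2 ^ j then Some 13 else if n = 132 * 2 ^ j + 1 then Some 9 else Some 2)"
  using assms
proof (induction j arbitrary: n)
  case 0
  then have "64 \<le> n div 2" "n div 2 < 128" "n = 2 * (n div 2) \<or> n = 2 * (n div 2) + 1" by auto
  then show ?case
    using state_of_rec[of n rs_dfa] rs_dfa_less_128(2)[of "n div 2"] 0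
    by (auto simp: rs_dfa_delta split: if_splits)
next
  case (Suc j)
  define x where "x = (2 :: nat) ^ j"
  have "1 \<le> x" by (simp add: x_def)
  have IH: "state_of rs_dfa (n div 2) =
    (if n div 2 = 128 * x then Some 10 else if n div 2 < 132 * x then None
     else if n div 2 = 132 * x then Some 13 else if n div 2 = 132 * x + 1 then Some 9 else Some 2)"
    using Suc unfolding x_def by simp
  have "0 < n" using Suc.prems by (auto intro: Nat.gr0I)
  have x: "2 ^ Suc j = 2 * x" by (simp add: x_def)
  consider "n = 256 * x" | "n = 256 * x + 1" | "256 * x + 2 \<le> n" "n < 264 * x" | "n = 264 * x"
    | "n = 264 * x + 1" | "n = 264 * x + 2 \<or> n = 264 * x + 3" | "264 * x + 4 \<le> n"
    using Suc.prems unfolding x by linarith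
  then show ?case
    unfolding x state_of_rec[OF \<open>0 < n\<close>] IH using \<open>1 \<le> x\<close>
    by cases (auto simp: rs_dfa_delta)
qed

lemma rs_dfa_accepts: "accepts rs_dfa (base2 n) \<longleftrightarrow> has_closed_factor rudin_shapiro n"
proof (cases "n < 128")
  case True
  have "\<not> (2 ^ k < n)" if "7 \<le> k" for k
    using True power_increasing[OF that, of "2 :: nat"] by simp
  then show ?thesis
    unfolding accepts_base2 rs_dfa_less_128(1)[OF True] rudin_shapiro_closed_iff by blast
next
  case False
  then have "0 < n div 128" by simp
  then obtain j where "2 ^ j \<le> n div 128" "n div 128 < 2 * 2 ^ j" by (rule power_of_2_between)
  then have n: "128 * 2 ^ j \<le> n" "n < 256 * 2 ^ j" by linarith+
  have p: "(2 :: nat) ^ (j + 7) = 128 * 2 ^ j" "(2 :: nat) ^ (j + 7 - 5) = 4 * 2 ^ j"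
    by (simp_all add: power_add)
  have uniq: "k = j + 7" if k: "7 \<le> k" "2 ^ k < n" "n \<le> 2 ^ k + 2 ^ (k - 5) + 1" for k
  proof (rule leading_power_eq)
    have "(2 :: nat) ^ k = 32 * 2 ^ (k - 5)" "2 \<le> (2 :: nat) ^ (k - 5)"
      using k(1) power_add[of "2 :: nat" 5 "k - 5"] power_increasing[of 1 "k - 5" "2 :: nat"] by simp_all
    then show "n < 2 * 2 ^ k" using k by linarith
  qed (use k n p in auto)
  have "(\<exists>k\<ge>7. 2 ^ k < n \<and> n \<le> 2 ^ k + 2 ^ (k - 5) + 1) \<longleftrightarrow>
      2 ^ (j + 7) < n \<and> n \<le> 2 ^ (j + 7) + 2 ^ (j + 7 - 5) + 1"
    using uniq by (intro ex_ge_unique[of 7 "j + 7" "\<lambda>k. 2 ^ k < n \<and> n \<le> 2 ^ k + 2 ^ (k - 5) + 1"]) simp_all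
  then have "(\<exists>k\<ge>7. 2 ^ k < n \<and> n \<le> 2 ^ k + 2 ^ (k - 5) + 1) \<longleftrightarrow>
      128 * 2 ^ j < n \<and> n \<le> 132 * 2 ^ j + 1"
    unfolding p by simp
  then have "has_closed_factor rudin_shapiro n \<longleftrightarrow> n = 128 * 2 ^ j \<or> 132 * 2 ^ j + 1 < n"
    using False n unfolding rudin_shapiro_closed_iff by auto
  note closed = this
  have fin: "(\<exists>q\<in>finals rs_dfa. s = Some q) \<longleftrightarrow>
      (case s of None \<Rightarrow> False | Some q \<Rightarrow> q < 15 \<and> q \<noteq> 9 \<and> q \<noteq> 13)"
    for s by (auto simp: rs_dfa_simps split: option.split)
  define x where "x = (2 :: nat) ^ j"
  have "0 < x" by (simp add: x_def)
  consider "n = 128 * x" | "128 * x < n" "n < 132 * x" | "n = 132 * x" | "n = 132 * x + 1"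
    | "132 * x + 1 < n" using n unfolding x_def by linarith
  then show ?thesis
    unfolding accepts_base2 fin rs_dfa_state[OF n] closed x_def[symmetric]
    using \<open>0 < x\<close> by cases simp_all
qed

text \<open>The states \<open>0, \<dots>, 9\<close> are those of 1, 2, 3, 4, 8, 9, 16, 17, 18, 34.\<close>

definition pf_dfa :: "nat dfa" where
  "pf_dfa = table_dfa
    [(Some 1, Some 2), (Some 3, Some 2), (Some 2, Some 2), (Some 4, Some 5), (Some 6, Some 7),
     (Some 8, Some 2), (None, None), (Some 9, Some 2), (Some 2, Some 2), (Some 9, Some 2),
     (None, Some 0)] {8, 9}"

lemma pf_dfa_simps:
  "states pf_dfa = {..<11}" "start pf_dfa = 10" "finals pf_dfa = {..<11} - {8, 9}"
proof -
  show states: "states pf_dfa = {..<11}" and "start pf_dfa = 10"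
    by (simp_all add: pf_dfa_def table_dfa_def)
  have "finals pf_dfa = states pf_dfa - {8, 9}" by (simp add: pf_dfa_def table_dfa_def)
  then show "finals pf_dfa = {..<11} - {8, 9}" by (simp only: states)
qed

lemma pf_dfa_delta:
  "delta pf_dfa q b =
    (if q < 11 then
       (if b then [Some 2, Some 2, Some 2, Some 5, Some 7, Some 2, None, Some 2, Some 2, Some 2,
          Some 0] ! q
        else [Some 1, Some 3, Some 2, Some 4, Some 6, Some 8, None, Some 9, Some 2, Some 9,
          None] ! q)
     else None)"
proof (cases "q < 11")
  case True
  then have "q \<in> set [0..<11]" by simp
  then show ?thesis by (auto simp: pf_dfa_def table_dfa_def upt_eval)
qed (simp add: pf_dfa_def table_dfa_def)

lemma pf_dfa_less_64:
  assumes "n < 64"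
  shows "n < 32 \<Longrightarrow> (\<exists>q\<in>finals pf_dfa. state_of pf_dfa n = Some q) \<longleftrightarrow> n \<noteq> 18"
    and "32 \<le> n \<Longrightarrow> state_of pf_dfa n =
      (if n < 34 then None else if n = 34 then Some 9 else Some 2)"
proof -
  have "list_all (\<lambda>n. (\<exists>q\<in>finals pf_dfa. state_of pf_dfa n = Some q) \<longleftrightarrow> n \<noteq> 18) [0..<32]"
    by (simp add: upt_eval state_of_numeral state_of_0 pf_dfa_simps pf_dfa_delta)
  then show "(\<exists>q\<in>finals pf_dfa. state_of pf_dfa n = Some q) \<longleftrightarrow> n \<noteq> 18" if "n < 32"
    using that by (simp only: list_all_iff set_upt atLeastLessThan_iff le0 simp_thms)
  have "list_all (\<lambda>n. state_of pf_dfa n =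
      (if n < 34 then None else if n = 34 then Some 9 else Some 2)) [32..<64]"
    by (simp add: upt_eval state_of_numeral state_of_0 pf_dfa_simps pf_dfa_delta)
  then show "state_of pf_dfa n = (if n < 34 then None else if n = 34 then Some 9 else Some 2)"
    if "32 \<le> n"
    using assms that by (simp only: list_all_iff set_upt atLeastLessThan_iff le0 simp_thms)
qed

text \<open>The excluded interval is everything from 32 2^j to 34 2^j. Below its upper end the run
  is already dead; 34 2^j stays in the rejecting state 9, whose odd successor lies past the next
  interval and enters the accepting sink 2.\<close>

lemma pf_dfa_state:
  assumes "32 * 2 ^ j \<le> n" "n < 64 * 2 ^ j"
  shows "state_of pf_dfa n =
    (if n < 34 * 2 ^ j then None else if n = 34 * 2 ^ j then Some 9 else Some 2)"
  using assms
proof (induction j arbitrary: n)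
  case 0
  then show ?case using pf_dfa_less_64(2)[of n] by simp
next
  case (Suc j)
  define x where "x = (2 :: nat) ^ j"
  have IH: "state_of pf_dfa (n div 2) =
    (if n div 2 < 34 * x then None else if n div 2 = 34 * x then Some 9 else Some 2)"
    using Suc unfolding x_def by simp
  have "0 < n" using Suc.prems by (auto intro: Nat.gr0I)
  have x: "2 ^ Suc j = 2 * x" by (simp add: x_def)
  consider "n < 68 * x" | "n = 68 * x" | "n = 68 * x + 1" | "68 * x + 2 \<le> n" by linarith
  then show ?case
    unfolding x state_of_rec[OF \<open>0 < n\<close>] IH by cases (auto simp: pf_dfa_delta)
qed

lemma pf_dfa_accepts: "accepts pf_dfa (base2 n) \<longleftrightarrow> has_closed_factor paperfolding n"
proof (cases "n < 32")
  case True
  have "\<not> (2 ^ k \<le> n)" if "5 \<le> k" for k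
    using True power_increasing[OF that, of "2 :: nat"] by simp
  moreover have "n < 64" using True by simp
  ultimately show ?thesis
    unfolding accepts_base2 pf_dfa_less_64(1)[OF \<open>n < 64\<close> True] paperfolding_closed_iff by blast
next
  case False
  then have "0 < n div 32" by simp
  then obtain j where "2 ^ j \<le> n div 32" "n div 32 < 2 * 2 ^ j" by (rule power_of_2_between)
  then have n: "32 * 2 ^ j \<le> n" "n < 64 * 2 ^ j" by linarith+
  have p: "(2 :: nat) ^ (j + 5) = 32 * 2 ^ j" "(2 :: nat) ^ (j + 5 - 4) = 2 * 2 ^ j"
    by (simp_all add: power_add)
  have uniq: "k = j + 5" if k: "5 \<le> k" "2 ^ k \<le> n" "n \<le> 2 ^ k + 2 ^ (k - 4)" for k
  proof (rule leading_power_eq)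
    have "(2 :: nat) ^ k = 16 * 2 ^ (k - 4)" "0 < (2 :: nat) ^ (k - 4)"
      using k(1) power_add[of "2 :: nat" 4 "k - 4"] by simp_all
    then show "n < 2 * 2 ^ k" using k by linarith
  qed (use k n p in auto)
  have "(\<exists>k\<ge>5. 2 ^ k \<le> n \<and> n \<le> 2 ^ k + 2 ^ (k - 4)) \<longleftrightarrow>
      2 ^ (j + 5) \<le> n \<and> n \<le> 2 ^ (j + 5) + 2 ^ (j + 5 - 4)"
    using uniq by (intro ex_ge_unique[of 5 "j + 5" "\<lambda>k. 2 ^ k \<le> n \<and> n \<le> 2 ^ k + 2 ^ (k - 4)"]) simp_all
  then have "(\<exists>k\<ge>5. 2 ^ k \<le> n \<and> n \<le> 2 ^ k + 2 ^ (k - 4)) \<longleftrightarrow> n \<le> 34 * 2 ^ j"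
    using n unfolding p by simp
  then have "has_closed_factor paperfolding n \<longleftrightarrow> 34 * 2 ^ j < n"
    using False unfolding paperfolding_closed_iff by auto
  moreover have "(\<exists>q\<in>finals pf_dfa. s = Some q) \<longleftrightarrow>
      (case s of None \<Rightarrow> False | Some q \<Rightarrow> q < 11 \<and> q \<noteq> 8 \<and> q \<noteq> 9)"
    for s by (auto simp: pf_dfa_simps split: option.split)
  ultimately show ?thesis
    unfolding accepts_base2 pf_dfa_state[OF n] by simp
qed

theorem theorem1:
  shows "(\<forall>n. has_closed_factor thue_morse n)
    \<and> dfa_with_states_accepting 15 (has_closed_factor rudin_shapiro)
    \<and> dfa_with_states_accepting 11 (has_closed_factor paperfolding)
    \<and> (\<forall>n. has_closed_factor period_doubling n)
    \<and> (\<forall>n. has_closed_factor fibonacci_word n)"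
proof (intro conjI allI)
  have "is_dfa rs_dfa" unfolding rs_dfa_def by (rule is_dfa_table_dfa) simp_all
  then show "dfa_with_states_accepting 15 (has_closed_factor rudin_shapiro)"
    unfolding dfa_with_states_accepting_def
    by (intro exI[of _ rs_dfa]) (simp add: rs_dfa_simps(1) rs_dfa_accepts)
  have "is_dfa pf_dfa" unfolding pf_dfa_def by (rule is_dfa_table_dfa) simp_all
  then show "dfa_with_states_accepting 11 (has_closed_factor paperfolding)"
    unfolding dfa_with_states_accepting_def
    by (intro exI[of _ pf_dfa]) (simp add: pf_dfa_simps(1) pf_dfa_accepts)
qed (rule thue_morse_closed period_doubling_closed fibonacci_closed)+

end
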